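(* Let $k,l$ be any integers with $l$ even. The variety $Y(k,l)$ is isomorphic to the subvariety $C(k,l)$ of $\mathbb{A}^2(r,y)$ defined by $$C(k,l):\quad f_n(t)\big(\Phi_{-k}(r)\Phi_{k-1}(r)(y-r)-1\big)+f_{n-1}(t)=0,$$ with $t=\Phi_{-k}(r)\Psi_k(r)(y-r)+2$ and $n=l/2$. The variety $X(k,l)$ is isomorphic to the double cover of $C(k,l)$ defined in $\mathbb{A}^2(r,x)$ by $y=x^2-2$.
   Context: Polynomials. $f_j\in\mathbb{Z}[u]$ ($j\in\mathbb{Z}$) is defined by $f_0=0$, $f_1=1$, $f_{j+1}-uf_j+f_{j-1}=0$ (up and down), and $g_j=f_j-f_{j-1}$. For all $j$, $\Phi_{2j}=f_j$ and $\Phi_{2j-1}=g_j$; for all $k$, $\Psi_k=\Phi_{k+1}-\Phi_{k-1}$. The knots. For integers $k,l$ with $kl$ even, $J(k,l)\subset \mathbb{S}^3$ is the double twist knot whose standard diagram has two twist regions with $k$ and $l$ half twists (positive: right-handed, negative: left-handed). It is the two-bridge knot $K(p,q)$, where $p,q$ are coprime odd integers, $-p<q\le p$, with $q/p=l/(1-kl)$ in $\mathbb{Q}/\mathbb{Z}$. For $l=2n$ even, $\pi_1(k,l):=\pi_1(\mathbb{S}^3\setminus J(k,l))\cong\langle a,b\mid a w_k^n=w_k^n b\rangle$, with $a,b$ meridians, $w_k=(ab^{-1})^m(a^{-1}b)^m$ if $k=2m$ and $w_k=(ab^{-1})^m ab(a^{-1}b)^m$ if $k=2m+1$. Character varieties.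 For a knot group $\Gamma$, let $R(\Gamma)=\mathrm{Hom}(\Gamma,\mathrm{SL}_2(\mathbb{C}))$, $\chi_\rho(\gamma)=\mathrm{tr}\,\rho(\gamma)$, and $t_\gamma(\rho)=\chi_\rho(\gamma)$. The set $\tilde X(\Gamma)=\{\chi_\rho\}$ is an affine algebraic set, whose coordinate ring is $T\otimes\mathbb{C}$ with $T$ the (finitely generated) ring of functions generated by $1$ and all $t_\gamma$. $X(\Gamma)\subset\tilde X(\Gamma)$ is the Zariski closed subset of characters of nonabelian representations (those with nonabelian image). The group $\mathrm{Hom}(\Gamma,\{\pm1\})\cong\{\pm1\}$ acts on $\tilde X(\Gamma)$ by $(\sigma\chi)(\gamma)=\sigma(\gamma)\chi(\gamma)$, and $Y(\Gamma)$ is the image of $X(\Gamma)$ in the quotient $\tilde X(\Gamma)/\{\pm1\}$. Write $X(k,l)=X(\pi_1(k,l))$, $Y(k,l)=Y(\pi_1(k,l))$. The coordinates are $r=t_{ab^{-1}}$, $x=t_a$, $y=t_{a^2}$. $\mathbb{A}^2(r,y)$ denotes the affine plane with coordinates $r,y$. *)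

theory Defs
  imports "HOL-Analysis.Analysis" "HOL-Algebra.Group"
    "HOL-Computational_Algebra.Polynomial"
begin

section \<open>The polynomials\<close>

function f_poly :: "int \<Rightarrow> int poly" where
  "f_poly j =
     (if j = 0 then 0
      else if j = 1 then 1
      else if j > 1 then [:0, 1:] * f_poly (j - 1) - f_poly (j - 2)
      else [:0, 1:] * f_poly (j + 1) - f_poly (j + 2))"
  by auto
termination
  by (relation "Wellfounded.measure (\<lambda>j. nat (if j \<ge> 0 then j else 1 - j))") auto

declare f_poly.simps [simp del]

lemma f_poly_0: "f_poly 0 = 0"
  by (simp add: f_poly.simps)

lemma f_poly_1: "f_poly 1 = 1"
  by (simp add: f_poly.simps)

lemma f_poly_rec: "f_poly (j + 1) - [:0, 1:] * f_poly j + f_poly (j - 1) = 0"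
proof (cases "j \<ge> 1")
  case True
  then show ?thesis
    using f_poly.simps[of "j + 1"] by simp
next
  case False
  then have "f_poly (j - 1) = [:0, 1:] * f_poly j - f_poly (j + 1)"
    using f_poly.simps[of "j - 1"] by (simp add: add.commute)
  then show ?thesis by simp
qed

definition g_poly :: "int \<Rightarrow> int poly" where
  "g_poly j = f_poly j - f_poly (j - 1)"

definition Phi_poly :: "int \<Rightarrow> int poly" where
  "Phi_poly k = (if even k then f_poly (k div 2) else g_poly ((k + 1) div 2))"

definition Psi_poly :: "int \<Rightarrow> int poly" where
  "Psi_poly k = Phi_poly (k + 1) - Phi_poly (k - 1)"

definition ipoly :: "int poly \<Rightarrow> complex \<Rightarrow> complex" where
  "ipoly p z = poly (map_poly of_int p) z"


section \<open>Groups given by generators and relations\<close>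

text \<open>A letter \<open>(x, True)\<close> stands for the generator \<open>x\<close> and
  \<open>(x, False)\<close> for its inverse. A relation \<open>s = t\<close> is a pair of words.\<close>

type_synonym 'a word = "('a \<times> bool) list"

definition word_inv :: "'a word \<Rightarrow> 'a word" where
  "word_inv u = rev (map (\<lambda>(x, e). (x, \<not> e)) u)"

definition word_pow :: "'a word \<Rightarrow> int \<Rightarrow> 'a word" where
  "word_pow u n =
     (if n \<ge> 0 then concat (replicate (nat n) u)
      else concat (replicate (nat (- n)) (word_inv u)))"

inductive word_cong :: "('a word \<times> 'a word) set \<Rightarrow> 'a word \<Rightarrow> 'a word \<Rightarrow> bool"
  for R where
  refl: "word_cong R u u"
| sym: "word_cong R u v \<Longrightarrow> word_cong R v u"
| trans: "word_cong R u v \<Longrightarrow> word_cong R v w \<Longrightarrow> word_cong R u w"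
| cancel: "word_cong R (u @ [(x, e), (x, \<not> e)] @ v) (u @ v)"
| rel: "(s, t) \<in> R \<Longrightarrow> word_cong R (u @ s @ v) (u @ t @ v)"

definition word_class :: "('a word \<times> 'a word) set \<Rightarrow> 'a word \<Rightarrow> 'a word set" where
  "word_class R u = {v. word_cong R u v}"

definition presented_group :: "('a word \<times> 'a word) set \<Rightarrow> 'a word set monoid" where
  "presented_group R =
     \<lparr>carrier = range (word_class R),
      mult = (\<lambda>A B. \<Union>u\<in>A. \<Union>v\<in>B. word_class R (u @ v)),
      one = word_class R []\<rparr>"

lemma word_class_eq_iff: "word_class R u = word_class R v \<longleftrightarrow> word_cong R u v"
proof
  assume "word_class R u = word_class R v"
  then show "word_cong R u v"
    using word_cong.refl[of R v] by (auto simp: word_class_def)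
next
  assume "word_cong R u v"
  then have "word_cong R u w \<longleftrightarrow> word_cong R v w" for w
    using word_cong.sym word_cong.trans by metis
  then show "word_class R u = word_class R v"
    by (simp add: word_class_def)
qed

lemma word_cong_append_left: "word_cong R u v \<Longrightarrow> word_cong R (w @ u) (w @ v)"
proof (induction rule: word_cong.induct)
  case (cancel u x e v)
  show ?case using word_cong.cancel[of R "w @ u" x e v] by simp
next
  case (rel s t u v)
  then show ?case using word_cong.rel[of s t R "w @ u" v] by simp
qed (fact word_cong.refl, erule word_cong.sym, erule (1) word_cong.trans)

lemma word_cong_append_right: "word_cong R u v \<Longrightarrow> word_cong R (u @ w) (v @ w)"
proof (induction rule: word_cong.induct)
  case (cancel u x e v)
  show ?case using word_cong.cancel[of R u x e "v @ w"] by simp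
next
  case (rel s t u v)
  then show ?case using word_cong.rel[of s t R u "v @ w"] by simp
qed (fact word_cong.refl, erule word_cong.sym, erule (1) word_cong.trans)

lemma presented_group_mult:
  "word_class R u \<otimes>\<^bsub>presented_group R\<^esub> word_class R v = word_class R (u @ v)"
proof -
  have "word_class R (u' @ v') = word_class R (u @ v)"
    if "u' \<in> word_class R u" "v' \<in> word_class R v" for u' v'
  proof -
    have "word_cong R u' u" "word_cong R v' v"
      using that word_cong.sym by (simp_all add: word_class_def)
    then show ?thesis
      unfolding word_class_eq_iff
      using word_cong_append_right word_cong_append_left word_cong.trans by metis
  qed
  moreover have "u \<in> word_class R u" "v \<in> word_class R v"
    by (simp_all add: word_class_def word_cong.refl)
  ultimately have "(\<Union>u'\<in>word_class R u. \<Union>v'\<in>word_class R v. word_class R (u' @ v')) =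
      word_class R (u @ v)"
    by blast
  then show ?thesis
    by (simp add: presented_group_def)
qed

lemma word_cong_inv: "word_cong R (word_inv u @ u) []"
proof (induction u)
  case Nil
  show ?case by (simp add: word_inv_def word_cong.refl)
next
  case (Cons l u)
  obtain x e where l: "l = (x, e)" by fastforce
  have "word_cong R (word_inv u @ [(x, \<not> e), (x, \<not> \<not> e)] @ u) (word_inv u @ u)"
    by (rule word_cong.cancel)
  then have "word_cong R (word_inv (l # u) @ l # u) (word_inv u @ u)"
    by (simp add: word_inv_def l)
  then show ?case using Cons.IH word_cong.trans by metis
qed

lemma group_presented_group: "group (presented_group R)"
proof (rule groupI)
  fix A assume "A \<in> carrier (presented_group R)"
  then obtain u where A: "A = word_class R u" by (auto simp: presented_group_def)
  have "word_class R (word_inv u) \<otimes>\<^bsub>presented_group R\<^esub> A = \<one>\<^bsub>presented_group R\<^esub>"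
    using word_cong_inv[of R u] unfolding A presented_group_mult
    by (simp add: presented_group_def word_class_eq_iff)
  then show "\<exists>B\<in>carrier (presented_group R). B \<otimes>\<^bsub>presented_group R\<^esub> A = \<one>\<^bsub>presented_group R\<^esub>"
    by (auto simp: presented_group_def)
next
  fix A assume "A \<in> carrier (presented_group R)"
  then obtain u where A: "A = word_class R u" by (auto simp: presented_group_def)
  have "\<one>\<^bsub>presented_group R\<^esub> = word_class R []" by (simp add: presented_group_def)
  then show "\<one>\<^bsub>presented_group R\<^esub> \<otimes>\<^bsub>presented_group R\<^esub> A = A"
    by (simp add: A presented_group_mult)
next
  fix A B assume "A \<in> carrier (presented_group R)" "B \<in> carrier (presented_group R)"
  then obtain u v where "A = word_class R u" "B = word_class R v"
    by (auto simp: presented_group_def)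
  then show "A \<otimes>\<^bsub>presented_group R\<^esub> B \<in> carrier (presented_group R)"
    by (simp add: presented_group_mult) (simp add: presented_group_def)
next
  fix A B C
  assume "A \<in> carrier (presented_group R)" "B \<in> carrier (presented_group R)"
    "C \<in> carrier (presented_group R)"
  then obtain u v w where "A = word_class R u" "B = word_class R v" "C = word_class R w"
    by (auto simp: presented_group_def)
  then show "A \<otimes>\<^bsub>presented_group R\<^esub> B \<otimes>\<^bsub>presented_group R\<^esub> C =
      A \<otimes>\<^bsub>presented_group R\<^esub> (B \<otimes>\<^bsub>presented_group R\<^esub> C)"
    by (simp add: presented_group_mult)
qed (auto simp: presented_group_def)


section \<open>The double twist knot groups\<close>

datatype gen = Gen_a | Gen_b

abbreviation wa :: "gen word" where "wa \<equiv> [(Gen_a, True)]"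
abbreviation wb :: "gen word" where "wb \<equiv> [(Gen_b, True)]"
abbreviation wa' :: "gen word" where "wa' \<equiv> [(Gen_a, False)]"
abbreviation wb' :: "gen word" where "wb' \<equiv> [(Gen_b, False)]"

text \<open>Since \<open>div\<close> rounds down, \<open>k = 2 * (k div 2) + 1\<close> for every odd \<open>k\<close>,
  negative ones included.\<close>

definition twist_word :: "int \<Rightarrow> gen word" where
  "twist_word k =
     (if even k
      then word_pow (wa @ wb') (k div 2) @ word_pow (wa' @ wb) (k div 2)
      else word_pow (wa @ wb') (k div 2) @ wa @ wb @ word_pow (wa' @ wb) (k div 2))"

definition twist_relations :: "int \<Rightarrow> int \<Rightarrow> (gen word \<times> gen word) set" where
  "twist_relations k l =
     {(wa @ word_pow (twist_word k) (l div 2), word_pow (twist_word k) (l div 2) @ wb)}"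

text \<open>The presentation of \<open>\<pi>\<^sub>1(S\<^sup>3 \<setminus> J(k,l))\<close>, for even \<open>l\<close>.\<close>

definition twist_knot_group :: "int \<Rightarrow> int \<Rightarrow> gen word set monoid" where
  "twist_knot_group k l = presented_group (twist_relations k l)"

definition meridian_a :: "int \<Rightarrow> int \<Rightarrow> gen word set" where
  "meridian_a k l = word_class (twist_relations k l) wa"

definition meridian_b :: "int \<Rightarrow> int \<Rightarrow> gen word set" where
  "meridian_b k l = word_class (twist_relations k l) wb"


section \<open>Complex affine varieties\<close>

text \<open>A (reduced, not necessarily irreducible) affine variety is represented by its set of
  points together with its coordinate ring, a \<open>\<complex>\<close>-algebra of functions on the points.
  Functions are made extensional, i.e. \<open>undefined\<close> outside the set of points.\<close>

record 'a variety =
  points :: "'a set"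
  regular :: "('a \<Rightarrow> complex) set"

inductive_set generated_algebra :: "('a \<Rightarrow> complex) set \<Rightarrow> ('a \<Rightarrow> complex) set"
  for G where
  const: "(\<lambda>_. c) \<in> generated_algebra G"
| gen: "F \<in> G \<Longrightarrow> F \<in> generated_algebra G"
| add: "F \<in> generated_algebra G \<Longrightarrow> H \<in> generated_algebra G \<Longrightarrow>
    (\<lambda>p. F p + H p) \<in> generated_algebra G"
| mult: "F \<in> generated_algebra G \<Longrightarrow> H \<in> generated_algebra G \<Longrightarrow>
    (\<lambda>p. F p * H p) \<in> generated_algebra G"

definition variety_with_coords :: "'a set \<Rightarrow> ('a \<Rightarrow> complex) set \<Rightarrow> 'a variety" where
  "variety_with_coords V G =
     \<lparr>points = V, regular = (\<lambda>F. restrict F V) ` generated_algebra G\<rparr>"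

definition affine_plane :: "(complex \<times> complex) variety" where
  "affine_plane = variety_with_coords UNIV {fst, snd}"

definition subvariety :: "'a variety \<Rightarrow> 'a set \<Rightarrow> 'a variety" where
  "subvariety V Z = \<lparr>points = Z, regular = (\<lambda>F. restrict F Z) ` regular V\<rparr>"

text \<open>The quotient by a finite group: \<open>q\<close> maps a point to its orbit, and a function on the
  orbits is regular iff its pullback, which is an invariant function, is regular.\<close>

definition quotient_variety :: "('a \<Rightarrow> 'b) \<Rightarrow> 'a variety \<Rightarrow> 'b variety" where
  "quotient_variety q V =
     \<lparr>points = q ` points V,
      regular = {F \<in> extensional (q ` points V).
                   restrict (\<lambda>p. F (q p)) (points V) \<in> regular V}\<rparr>"

definition variety_iso :: "('a \<Rightarrow> 'b) \<Rightarrow> 'a variety \<Rightarrow> 'b variety \<Rightarrow> bool" where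
  "variety_iso \<phi> V W \<longleftrightarrow>
     bij_betw \<phi> (points V) (points W) \<and>
     (\<lambda>F. restrict (\<lambda>p. F (\<phi> p)) (points V)) ` regular W = regular V"


section \<open>Character varieties\<close>

definition SL2 :: "(complex ^ 2 ^ 2) monoid" where
  "SL2 = \<lparr>carrier = {A. det A = 1}, mult = (**), one = mat 1\<rparr>"

definition sign_group :: "complex monoid" where
  "sign_group = \<lparr>carrier = {1, -1}, mult = (*), one = 1\<rparr>"

definition char_of ::
    "('g, 'm) monoid_scheme \<Rightarrow> ('g \<Rightarrow> complex ^ 2 ^ 2) \<Rightarrow> 'g \<Rightarrow> complex" where
  "char_of \<Gamma> \<rho> = (\<lambda>\<gamma>\<in>carrier \<Gamma>. trace (\<rho> \<gamma>))"

definition nonabelian_rep ::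
    "('g, 'm) monoid_scheme \<Rightarrow> ('g \<Rightarrow> complex ^ 2 ^ 2) \<Rightarrow> bool" where
  "nonabelian_rep \<Gamma> \<rho> \<longleftrightarrow>
     (\<exists>\<gamma>\<in>carrier \<Gamma>. \<exists>\<delta>\<in>carrier \<Gamma>. \<rho> \<gamma> ** \<rho> \<delta> \<noteq> \<rho> \<delta> ** \<rho> \<gamma>)"

text \<open>If \<open>T\<close> is the ring generated by the functions \<open>t\<^sub>\<gamma>\<close>, the coordinate ring
  \<open>T \<otimes> \<complex>\<close> is the \<open>\<complex>\<close>-algebra of functions that they generate.\<close>

definition X_tilde :: "('g, 'm) monoid_scheme \<Rightarrow> ('g \<Rightarrow> complex) variety" where
  "X_tilde \<Gamma> = variety_with_coords (char_of \<Gamma> ` hom \<Gamma> SL2) ((\<lambda>\<gamma> \<xi>. \<xi> \<gamma>) ` carrier \<Gamma>)"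

definition nonabelian_chars :: "('g, 'm) monoid_scheme \<Rightarrow> ('g \<Rightarrow> complex) set" where
  "nonabelian_chars \<Gamma> = {char_of \<Gamma> \<rho> | \<rho>. \<rho> \<in> hom \<Gamma> SL2 \<and> nonabelian_rep \<Gamma> \<rho>}"

definition X_variety :: "('g, 'm) monoid_scheme \<Rightarrow> ('g \<Rightarrow> complex) variety" where
  "X_variety \<Gamma> = subvariety (X_tilde \<Gamma>) (nonabelian_chars \<Gamma>)"

definition sign_orbit ::
    "('g, 'm) monoid_scheme \<Rightarrow> ('g \<Rightarrow> complex) \<Rightarrow> ('g \<Rightarrow> complex) set" where
  "sign_orbit \<Gamma> \<xi> = {(\<lambda>\<gamma>\<in>carrier \<Gamma>. \<sigma> \<gamma> * \<xi> \<gamma>) | \<sigma>. \<sigma> \<in> hom \<Gamma> sign_group}"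

definition Y_variety :: "('g, 'm) monoid_scheme \<Rightarrow> ('g \<Rightarrow> complex) set variety" where
  "Y_variety \<Gamma> =
     subvariety (quotient_variety (sign_orbit \<Gamma>) (X_tilde \<Gamma>))
       (sign_orbit \<Gamma> ` nonabelian_chars \<Gamma>)"


section \<open>The plane models\<close>

definition t_poly :: "int \<Rightarrow> complex \<Rightarrow> complex \<Rightarrow> complex" where
  "t_poly k r y = ipoly (Phi_poly (- k)) r * ipoly (Psi_poly k) r * (y - r) + 2"

definition C_set :: "int \<Rightarrow> int \<Rightarrow> (complex \<times> complex) set" where
  "C_set k l =
     {(r, y). let n = l div 2; t = t_poly k r y in
        ipoly (f_poly n) t * (ipoly (Phi_poly (- k)) r * ipoly (Phi_poly (k - 1)) r * (y - r) - 1)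
          + ipoly (f_poly (n - 1)) t = 0}"

definition C_variety :: "int \<Rightarrow> int \<Rightarrow> (complex \<times> complex) variety" where
  "C_variety k l = subvariety affine_plane (C_set k l)"

definition C_double_cover :: "int \<Rightarrow> int \<Rightarrow> (complex \<times> complex) variety" where
  "C_double_cover k l = subvariety affine_plane {(r, x). (r, x\<^sup>2 - 2) \<in> C_set k l}"

end

theory Submission
  imports Defs
begin

text \<open>
A representation of the group of \<open>J(k,l)\<close> in \<open>SL\<^sub>2(\<complex>)\<close> is a pair of unimodular matrices
\<open>A, B\<close> with \<open>A W\<^sup>n = W\<^sup>n B\<close>, where \<open>W\<close> is the value of \<open>w\<^sub>k\<close> and \<open>n = l/2\<close>. The relation makes
\<open>A\<close> and \<open>B\<close> conjugate; let \<open>x\<close> be their common trace, \<open>r\<close> the trace of \<open>A B\<^sup>-\<^sup>1\<close> and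
\<open>y = x\<^sup>2 - 2\<close>. By the Cayley-Hamilton theorem every word in \<open>A\<close> and \<open>B\<close> is a combination of
\<open>1, A, B, A B\<close> whose coefficients are polynomials in \<open>r\<close> and \<open>x\<close> (lemmas \<open>eval2_lin\<close> and
\<open>word_coeffs_polynomial\<close>). So a character is determined by its point \<open>(r, x)\<close>, and the functions
\<open>t\<^sub>\<gamma>\<close> generate the algebra of polynomials in \<open>r\<close> and \<open>x\<close>.

The word \<open>w\<^sub>k\<close> is fixed by the anti-automorphism of the free group that exchanges \<open>a\<close> and \<open>b\<close>.
Accordingly \<open>W = \<alpha> + \<beta> (A + B) + \<gamma> A B\<close>, and for matrices of this form
\<open>A W - W B = (\<alpha> + \<beta> x + \<gamma>) (A - B)\<close> (lemma \<open>symmetric_defect\<close>). The two twist regions are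
powers of matrices of trace \<open>r\<close>, which gives
\<open>\<alpha> + \<beta> x + \<gamma> = 1 - \<Phi>\<^sub>-\<^sub>k \<Phi>\<^sub>k\<^sub>-\<^sub>1 (y - r)\<close> and \<open>tr W = t\<close> (lemma \<open>twist_word_symmetric\<close>).
Since \<open>W\<^sup>n = f\<^sub>n(t) W - f\<^sub>n\<^sub>-\<^sub>1(t)\<close>, the matrix \<open>A W\<^sup>n - W\<^sup>n B\<close> is \<open>B - A\<close> times the left-hand
side of the equation of \<open>C(k,l)\<close>: the relation holds if and only if \<open>A = B\<close> or \<open>(r, y)\<close> lies on
\<open>C(k,l)\<close> (lemma \<open>relation_iff\<close>). This computation does not distinguish reducible from irreducible
pairs.

A nonabelian representation has \<open>A \<noteq> B\<close>, so its point lies on the curve. Conversely \<open>y \<noteq> r\<close> on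
\<open>C(k,l)\<close>, because the left-hand side of its equation is \<open>-1\<close> for \<open>y = r\<close>; and for \<open>y \<noteq> r\<close> a pair
of triangular matrices with these \<open>r\<close> and \<open>x\<close> does not commute (lemma
\<open>noncommuting_pair_exists\<close>). This settles \<open>X(k,l)\<close>. The nontrivial sign acts by
\<open>(r, x) \<mapsto> (r, -x)\<close>, so the orbits correspond to the points \<open>(r, y)\<close>, and an invariant polynomial
in \<open>r\<close> and \<open>x\<close> is a polynomial in \<open>r\<close> and \<open>x\<^sup>2\<close> on the characters, which settles \<open>Y(k,l)\<close>.
\<close>

section \<open>Values of the polynomials\<close>

lemma ipoly_diff: "ipoly (p - q) z = ipoly p z - ipoly q z"
proof -
  have "map_poly of_int (p - q) = (map_poly of_int p - map_poly of_int q :: complex poly)"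
    by (simp add: poly_eq_iff coeff_map_poly)
  then show ?thesis by (simp add: ipoly_def)
qed

lemma ipoly_shift: "ipoly ([:0, 1:] * p) z = z * ipoly p z"
  by (simp add: ipoly_def map_poly_pCons)

abbreviation fval :: "int \<Rightarrow> complex \<Rightarrow> complex" where
  "fval j z \<equiv> ipoly (f_poly j) z"

lemma fval_0 [simp]: "fval 0 z = 0"
  by (simp add: f_poly_0 ipoly_def)

lemma fval_1 [simp]: "fval 1 z = 1"
  by (simp add: f_poly_1 ipoly_def)

lemma fval_Suc: "fval (j + 1) z = z * fval j z - fval (j - 1) z"
proof -
  have "f_poly (j + 1) = [:0, 1:] * f_poly j - f_poly (j - 1)"
    using f_poly_rec[of j] by (subst eq_iff_diff_eq_0) (simp only: diff_diff_eq2 diff_add_eq)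
  then show ?thesis by (simp only: ipoly_diff ipoly_shift)
qed

text \<open>The recursion with its indices as variables: a rule application then leaves only
  linear arithmetic on the indices, whatever form they have.\<close>

lemma fval_up: "j = i + 1 \<Longrightarrow> k = j + 1 \<Longrightarrow> fval k z = z * fval j z - fval i z"
  using fval_Suc[of j z] by simp

lemma fval_down: "j = i + 1 \<Longrightarrow> k = j + 1 \<Longrightarrow> fval i z = z * fval j z - fval k z"
  using fval_Suc[of j z] by simp

text \<open>The matrix \<open>f\<^sub>j(z) M - f\<^sub>j\<^sub>-\<^sub>1(z)\<close> is the \<open>j\<close>-th power of a unimodular matrix \<open>M\<close> of trace
  \<open>z\<close>, and the left-hand side is its determinant.\<close>

lemma fval_invariant: "(fval j z)\<^sup>2 + (fval (j - 1) z)\<^sup>2 - z * fval j z * fval (j - 1) z = 1"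
proof (induction j rule: int_induct[of _ 1])
  case (step1 i)
  have "fval (i + 1) z = z * fval i z - fval (i - 1) z" by (rule fval_Suc)
  with step1(2) have "(fval (i + 1) z)\<^sup>2 + (fval i z)\<^sup>2 - z * fval (i + 1) z * fval i z = 1" by algebra
  then show ?case by simp
next
  case (step2 i)
  have "fval (i - 1 - 1) z = z * fval (i - 1) z - fval i z" by (rule fval_down) simp_all
  with step2(2) show ?case by algebra
qed simp

lemma fval_minus: "fval (- j) z = - fval j z"
proof -
  have "fval (- j) z = - fval j z \<and> fval (- (j + 1)) z = - fval (j + 1) z"
  proof (induction j rule: int_induct[of _ 0])
    case base
    have "fval (- 1) z = z * fval 0 z - fval 1 z" by (rule fval_down) simp_all
    then show ?case by simp
  next
    case (step1 i)
    have "fval (- (i + 1 + 1)) z = z * fval (- (i + 1)) z - fval (- i) z"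
      by (rule fval_down) simp_all
    moreover have "fval (i + 1 + 1) z = z * fval (i + 1) z - fval i z"
      by (rule fval_up) simp_all
    ultimately show ?case using step1(2) by (simp only: mult_minus_right) simp
  next
    case (step2 i)
    have "fval (- (i - 1)) z = z * fval (- i) z - fval (- (i + 1)) z"
      by (rule fval_up) simp_all
    moreover have "fval (i - 1) z = z * fval i z - fval (i + 1) z"
      by (rule fval_down) simp_all
    ultimately show ?case using step2(2) by (simp only: mult_minus_right diff_add_cancel) simp
  qed
  then show ?thesis ..
qed

lemma fval_at_2: "fval j 2 = of_int j"
proof -
  have "fval j 2 = of_int j \<and> fval (j + 1) 2 = of_int (j + 1)"
  proof (induction j rule: int_induct[of _ 0])
    case (step1 i)
    have "fval (i + 1 + 1) 2 = 2 * fval (i + 1) 2 - fval i 2" by (rule fval_up) simp_all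
    with step1 show ?case by simp
  next
    case (step2 i)
    have "fval (i - 1) 2 = 2 * fval i 2 - fval (i + 1) 2" by (rule fval_down) simp_all
    with step2 show ?case by simp
  qed simp
  then show ?thesis ..
qed

lemma Phi_even: "ipoly (Phi_poly (2 * m)) z = fval m z"
  by (simp add: Phi_poly_def)

lemma Phi_odd: "ipoly (Phi_poly (2 * m + 1)) z = fval (m + 1) z - fval m z"
  by (simp add: Phi_poly_def g_poly_def ipoly_diff add.commute)

lemma Psi_even: "ipoly (Psi_poly (2 * m)) z = (z - 2) * fval m z"
proof -
  have e: "2 * m - 1 = 2 * (m - 1) + 1" by simp
  have "ipoly (Psi_poly (2 * m)) z = (fval (m + 1) z - fval m z) - (fval (m - 1 + 1) z - fval (m - 1) z)"
    unfolding Psi_poly_def ipoly_diff e Phi_odd ..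
  then show ?thesis by (simp add: fval_Suc left_diff_distrib)
qed

lemma Psi_odd: "ipoly (Psi_poly (2 * m + 1)) z = fval (m + 1) z - fval m z"
proof -
  have e: "2 * m + 1 + 1 = 2 * (m + 1)" "2 * m + 1 - 1 = 2 * m" by simp_all
  show ?thesis unfolding Psi_poly_def ipoly_diff e Phi_even ..
qed

section \<open>Words in a group\<close>

fun word_eval :: "('b, 'm) monoid_scheme \<Rightarrow> ('a \<Rightarrow> 'b) \<Rightarrow> 'a word \<Rightarrow> 'b" where
  "word_eval G h [] = \<one>\<^bsub>G\<^esub>"
| "word_eval G h ((x, e) # u) = (if e then h x else inv\<^bsub>G\<^esub> (h x)) \<otimes>\<^bsub>G\<^esub> word_eval G h u"

context group
begin

context
  fixes h :: "'c \<Rightarrow> 'a"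
  assumes h [simp]: "\<And>x. h x \<in> carrier G"
begin

lemma word_eval_closed [simp]: "word_eval G h u \<in> carrier G"
  by (induction u) auto

lemma word_eval_append: "word_eval G h (u @ v) = word_eval G h u \<otimes> word_eval G h v"
  by (induction u) (auto simp: m_assoc)

lemma word_eval_inv: "word_eval G h (word_inv u) = inv (word_eval G h u)"
proof (induction u)
  case Nil
  then show ?case by (simp add: word_inv_def)
next
  case (Cons s u)
  obtain x e where s: "s = (x, e)" by fastforce
  have "word_inv (s # u) = word_inv u @ [(x, \<not> e)]" by (simp add: word_inv_def s)
  then show ?case by (simp add: word_eval_append Cons s inv_mult_group)
qed

lemma word_eval_replicate: "word_eval G h (concat (replicate n u)) = word_eval G h u [^] n"
proof (induction n)
  case (Suc n)
  then show ?case
    using nat_pow_Suc2[OF word_eval_closed[of u], of n] by (simp add: word_eval_append)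
qed simp

lemma word_eval_pow: "word_eval G h (word_pow u n) = word_eval G h u [^] n"
proof (cases "n \<ge> 0")
  case True
  then obtain m where "n = int m" by (auto elim: nonneg_int_cases)
  then show ?thesis by (simp add: word_pow_def word_eval_replicate int_pow_int)
next
  case False
  then obtain m where n: "n = - int m" by (metis int_cases4 le_cases neg_0_le_iff_le nonneg_int_cases minus_minus)
  then have "word_eval G h (word_pow u n) = word_eval G h (word_inv u) [^] m"
    using False by (simp add: word_pow_def word_eval_replicate)
  also have "\<dots> = word_eval G h u [^] n"
    by (simp add: n word_eval_inv int_pow_neg int_pow_int nat_pow_inv)
  finally show ?thesis .
qed

text \<open>The universal property of a presentation: an evaluation that respects the relations respects the
  congruence that they generate, and hence factors through the presented group.\<close>

lemma word_eval_cong: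
  assumes "word_cong R u v" "\<And>s t. (s, t) \<in> R \<Longrightarrow> word_eval G h s = word_eval G h t"
  shows "word_eval G h u = word_eval G h v"
  using assms(1)
proof (induction rule: word_cong.induct)
  case (cancel u x e v)
  have "h x \<otimes> (inv h x \<otimes> z) = z" "inv h x \<otimes> (h x \<otimes> z) = z" if "z \<in> carrier G" for z
    using that by (simp_all flip: m_assoc)
  then show ?case by (cases e) (simp_all add: word_eval_append)
qed (simp_all add: word_eval_append assms(2))

lemma presented_hom_exists:
  assumes "\<And>s t. (s, t) \<in> R \<Longrightarrow> word_eval G h s = word_eval G h t"
  obtains \<rho> where "\<rho> \<in> hom (presented_group R) G" "\<And>u. \<rho> (word_class R u) = word_eval G h u"
proof
  define \<rho> where "\<rho> C = word_eval G h (SOME u. C = word_class R u)" for C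
  show \<rho>: "\<rho> (word_class R u) = word_eval G h u" for u
  proof -
    have "word_class R u = word_class R (SOME v. word_class R u = word_class R v)"
      by (rule someI) simp
    then have "word_cong R u (SOME v. word_class R u = word_class R v)"
      by (simp add: word_class_eq_iff)
    from word_eval_cong[OF this assms] show ?thesis by (simp add: \<rho>_def)
  qed
  have "carrier (presented_group R) = range (word_class R)"
    by (simp add: presented_group_def)
  then show "\<rho> \<in> hom (presented_group R) G"
    by (auto simp: hom_def \<rho> presented_group_mult word_eval_append)
qed

end

lemma presented_hom_eval:
  assumes "\<rho> \<in> hom (presented_group R) G"
  shows "\<rho> (word_class R u) = word_eval G (\<lambda>x. \<rho> (word_class R [(x, True)])) u"
proof -
  interpret P: group "presented_group R" by (rule group_presented_group)
  interpret \<rho>: group_hom "presented_group R" G \<rho>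
    by unfold_locales (rule assms)
  have car: "word_class R v \<in> carrier (presented_group R)" for v
    by (simp add: presented_group_def)
  have one: "\<one>\<^bsub>presented_group R\<^esub> = word_class R []"
    by (simp add: presented_group_def)
  have inv: "word_class R [(x, False)] = inv\<^bsub>presented_group R\<^esub> word_class R [(x, True)]" for x
  proof (rule P.inv_equality[symmetric])
    show "word_class R [(x, False)] \<otimes>\<^bsub>presented_group R\<^esub> word_class R [(x, True)] = \<one>\<^bsub>presented_group R\<^esub>"
      using word_cong.cancel[of R "[]" x False "[]"]
      by (simp add: presented_group_mult one word_class_eq_iff)
  qed (rule car)+
  show ?thesis
  proof (induction u)
    case Nil
    show ?case using \<rho>.hom_one by (simp add: one)
  next
    case (Cons s u)
    obtain x e where s: "s = (x, e)" by fastforce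
    have "word_class R (s # u) = word_class R [s] \<otimes>\<^bsub>presented_group R\<^esub> word_class R u"
      by (simp add: presented_group_mult)
    then have "\<rho> (word_class R (s # u)) = \<rho> (word_class R [s]) \<otimes> \<rho> (word_class R u)"
      by (simp add: car)
    also have "\<rho> (word_class R [s]) =
        (if e then \<rho> (word_class R [(x, True)]) else inv \<rho> (word_class R [(x, True)]))"
      by (simp add: s inv car)
    finally show ?case by (simp add: s Cons)
  qed
qed

end

section \<open>Two by two matrices\<close>

definition cscale :: "complex \<Rightarrow> complex ^ 2 ^ 2 \<Rightarrow> complex ^ 2 ^ 2" where
  "cscale c A = (\<chi> i j. c * A $ i $ j)"

text \<open>The adjugate, in the form \<open>tr A - A\<close>; it is the inverse of a unimodular matrix.\<close>

definition adj2 :: "complex ^ 2 ^ 2 \<Rightarrow> complex ^ 2 ^ 2" where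
  "adj2 A = cscale (trace A) (mat 1) - A"

lemma mat2_eq_iff:
  fixes A B :: "complex ^ 2 ^ 2"
  shows "A = B \<longleftrightarrow> A $ 1 $ 1 = B $ 1 $ 1 \<and> A $ 1 $ 2 = B $ 1 $ 2 \<and>
    A $ 2 $ 1 = B $ 2 $ 1 \<and> A $ 2 $ 2 = B $ 2 $ 2"
  by (auto simp: vec_eq_iff forall_2)

lemma mult_entry: "(A ** B) $ i $ j = A $ i $ 1 * B $ 1 $ j + A $ i $ 2 * B $ 2 $ j"
  for A B :: "complex ^ 2 ^ 2"
  by (simp add: matrix_matrix_mult_def sum_2)

lemma trace_2: "trace A = A $ 1 $ 1 + A $ 2 $ 2" for A :: "complex ^ 2 ^ 2"
  by (simp add: trace_def sum_2)

lemma cscale_entry [simp]: "cscale c A $ i $ j = c * A $ i $ j"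
  by (simp add: cscale_def)

lemma mat_entry: "mat (c :: complex) $ i $ j = (if i = j then c else 0)"
  by (simp add: mat_def)

lemmas mat2_simps = mat2_eq_iff mult_entry trace_2 mat_entry det_2 adj2_def

lemma adj2_mult: "det A = 1 \<Longrightarrow> adj2 A ** A = mat 1" "det A = 1 \<Longrightarrow> A ** adj2 A = mat 1"
  by (auto simp: mat2_simps algebra_simps)

lemma det_adj2: "det (adj2 A) = det A"
  by (simp add: mat2_simps)

lemma cayley_hamilton_2: "A ** A = cscale (trace A) A - cscale (det A) (mat 1)"
  by (simp add: mat2_simps algebra_simps)

lemma group_SL2: "group SL2"
proof (rule groupI)
  fix A assume "A \<in> carrier SL2"
  then show "\<exists>B\<in>carrier SL2. B \<otimes>\<^bsub>SL2\<^esub> A = \<one>\<^bsub>SL2\<^esub>"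
    by (intro bexI[of _ "adj2 A"]) (auto simp: SL2_def adj2_mult det_adj2)
qed (auto simp: SL2_def det_mul matrix_mul_assoc)

interpretation SL2: group SL2
  by (rule group_SL2)

lemma SL2_simps [simp]: "A \<in> carrier SL2 \<longleftrightarrow> det A = 1" "A \<otimes>\<^bsub>SL2\<^esub> B = A ** B" "\<one>\<^bsub>SL2\<^esub> = mat 1"
  by (simp_all add: SL2_def)

lemma inv_SL2: "det A = 1 \<Longrightarrow> inv\<^bsub>SL2\<^esub> A = adj2 A"
  by (intro SL2.inv_equality) (simp_all add: adj2_mult det_adj2)

text \<open>The recursion of the \<open>f\<^sub>j\<close> is the Cayley-Hamilton relation \<open>A\<^sup>2 = tr A \<cdot> A - 1\<close>, read as a
  recursion for the powers of \<open>A\<close> in both directions.\<close>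

lemma SL2_pow:
  assumes "det A = 1"
  shows "A [^]\<^bsub>SL2\<^esub> n = cscale (fval n (trace A)) A - cscale (fval (n - 1) (trace A)) (mat 1)"
    (is "_ = ?R n")
proof (induction n rule: int_induct[of _ 0])
  case base
  show ?case using fval_minus[of 1 "trace A"] by (simp add: mat2_simps)
next
  case (step1 i)
  have "A [^]\<^bsub>SL2\<^esub> (i + 1) = ?R i ** A"
    using step1 assms by (simp add: SL2.int_pow_mult)
  also have "\<dots> = cscale (fval i (trace A)) (A ** A) - cscale (fval (i - 1) (trace A)) A"
    by (simp add: mat2_simps algebra_simps)
  also have "\<dots> = ?R (i + 1)"
    unfolding cayley_hamilton_2 fval_Suc using assms by (simp add: mat2_eq_iff algebra_simps)
  finally show ?case .
next
  case (step2 i)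
  have "A [^]\<^bsub>SL2\<^esub> (i - 1) = ?R i ** adj2 A"
    using step2 assms by (simp add: SL2.int_pow_diff inv_SL2)
  also have "\<dots> = cscale (fval i (trace A)) (A ** adj2 A) - cscale (fval (i - 1) (trace A)) (adj2 A)"
    by (simp add: mat2_simps algebra_simps)
  also have "\<dots> = ?R (i - 1)"
  proof -
    have "fval (i - 1 - 1) (trace A) = trace A * fval (i - 1) (trace A) - fval i (trace A)"
      by (rule fval_down) simp_all
    then show ?thesis
      unfolding adj2_mult(2)[OF assms] unfolding adj2_def by (simp add: mat2_eq_iff mat_entry algebra_simps)
  qed
  finally show ?case .
qed

section \<open>The algebra generated by two matrices of equal trace\<close>

type_synonym quad = "complex \<times> complex \<times> complex \<times> complex"

definition lin_comb :: "complex ^ 2 ^ 2 \<Rightarrow> complex ^ 2 ^ 2 \<Rightarrow> quad \<Rightarrow> complex ^ 2 ^ 2" where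
  "lin_comb A B = (\<lambda>(\<alpha>, \<beta>, \<gamma>, \<delta>). cscale \<alpha> (mat 1) + cscale \<beta> A + cscale \<gamma> B + cscale \<delta> (A ** B))"

text \<open>Left multiplication by \<open>A\<close> and by \<open>B\<close> in coordinates with respect to \<open>1, A, B, A B\<close>, for unimodular
  \<open>A, B\<close> of trace \<open>x\<close> with \<open>tr A B\<^sup>-\<^sup>1 = r\<close>. The matrices may be linearly dependent, so the
  coordinates of a matrix need not be unique; they are computed formally from the word.\<close>

fun gen_coeffs :: "complex \<Rightarrow> complex \<Rightarrow> gen \<Rightarrow> quad \<Rightarrow> quad" where
  "gen_coeffs r x Gen_a (\<alpha>, \<beta>, \<gamma>, \<delta>) = (- \<beta>, \<alpha> + x * \<beta>, - \<delta>, \<gamma> + x * \<delta>)"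
| "gen_coeffs r x Gen_b (\<alpha>, \<beta>, \<gamma>, \<delta>) =
    (- r * \<beta> - \<gamma> - x * \<delta>, x * \<beta> + \<delta>, \<alpha> + x * \<beta> + x * \<gamma> + (x * x - r) * \<delta>, - \<beta>)"

fun letter_coeffs :: "complex \<Rightarrow> complex \<Rightarrow> gen \<times> bool \<Rightarrow> quad \<Rightarrow> quad" where
  "letter_coeffs r x (g, True) v = gen_coeffs r x g v"
| "letter_coeffs r x (g, False) (\<alpha>, \<beta>, \<gamma>, \<delta>) =
    (case gen_coeffs r x g (\<alpha>, \<beta>, \<gamma>, \<delta>) of
       (\<alpha>', \<beta>', \<gamma>', \<delta>') \<Rightarrow> (x * \<alpha> - \<alpha>', x * \<beta> - \<beta>', x * \<gamma> - \<gamma>', x * \<delta> - \<delta>'))"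

fun word_coeffs :: "complex \<Rightarrow> complex \<Rightarrow> gen word \<Rightarrow> quad" where
  "word_coeffs r x [] = (1, 0, 0, 0)"
| "word_coeffs r x (s # u) = letter_coeffs r x s (word_coeffs r x u)"

lemma mult_add_right: "A ** (X + Y) = A ** X + A ** Y" for A :: "complex ^ 2 ^ 2"
  by (rule matrix_add_ldistrib)

lemma mult_cscale_right: "A ** cscale c X = cscale c (A ** X)"
  by (simp add: mat2_simps algebra_simps)

text \<open>The polarised Cayley-Hamilton identity
  \<open>A B + B A = tr A \<cdot> B + tr B \<cdot> A + tr (A B) - tr A \<cdot> tr B\<close>, with \<open>tr A \<cdot> tr B - tr (A B) = r\<close>.\<close>

lemma BA_eq:
  assumes "trace A = x" "trace B = x" "trace (A ** adj2 B) = r"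
  shows "B ** A = lin_comb A B (- r, x, x, - 1)"
proof -
  have r: "r = A $ 1 $ 1 * B $ 2 $ 2 - A $ 1 $ 2 * B $ 2 $ 1 - A $ 2 $ 1 * B $ 1 $ 2 + A $ 2 $ 2 * B $ 1 $ 1"
    using assms(3) by (simp add: mat2_simps algebra_simps)
  have xA: "x = A $ 1 $ 1 + A $ 2 $ 2" and xB: "x = B $ 1 $ 1 + B $ 2 $ 2"
    using assms by (simp_all add: trace_2)
  have b: "B $ 2 $ 2 = A $ 1 $ 1 + A $ 2 $ 2 - B $ 1 $ 1" using xA xB by (simp add: algebra_simps)
  show ?thesis
    unfolding r xA lin_comb_def by (simp add: mat2_eq_iff mult_entry mat_entry b algebra_simps)
qed

lemma mult_lin_A:
  assumes "det A = 1" "trace A = x"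
  shows "A ** lin_comb A B v = lin_comb A B (gen_coeffs r x Gen_a v)"
proof -
  obtain \<alpha> \<beta> \<gamma> \<delta> where v: "v = (\<alpha>, \<beta>, \<gamma>, \<delta>)" by (cases v)
  have "A ** lin_comb A B v = cscale \<alpha> A + cscale \<beta> (A ** A) + cscale \<gamma> (A ** B) + cscale \<delta> (A ** A ** B)"
    by (simp add: v lin_comb_def mult_add_right mult_cscale_right matrix_mul_assoc)
  then show ?thesis
    unfolding cayley_hamilton_2 v using assms
    by (simp add: lin_comb_def mat2_eq_iff mult_entry mat_entry algebra_simps)
qed

lemma mult_lin_B:
  assumes "det A = 1" "trace A = x" "det B = 1" "trace B = x" "trace (A ** adj2 B) = r"
  shows "B ** lin_comb A B v = lin_comb A B (gen_coeffs r x Gen_b v)"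
proof -
  obtain \<alpha> \<beta> \<gamma> \<delta> where v: "v = (\<alpha>, \<beta>, \<gamma>, \<delta>)" by (cases v)
  have AB2: "(A ** B) ** B = cscale x (A ** B) - A"
    unfolding matrix_mul_assoc[symmetric] cayley_hamilton_2 using assms
    by (simp add: mat2_eq_iff mult_entry mat_entry algebra_simps)
  have BB: "B ** B = cscale x B - mat 1"
    unfolding cayley_hamilton_2 using assms by (simp add: mat2_eq_iff)
  have BA: "B ** A = lin_comb A B (- r, x, x, - 1)" by (rule BA_eq) (use assms in auto)
  have "B ** (A ** B) = lin_comb A B (- r, x, x, - 1) ** B"
    by (simp add: matrix_mul_assoc BA)
  also have "\<dots> = cscale (- r) B + cscale x (A ** B) + cscale x (B ** B) - (A ** B) ** B"
    by (simp add: lin_comb_def mat2_eq_iff mult_entry mat_entry algebra_simps)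
  finally have BAB: "B ** (A ** B) = lin_comb A B (- x, 1, x * x - r, 0)"
    unfolding AB2 BB lin_comb_def by (simp add: mat2_eq_iff mat_entry algebra_simps)
  have "B ** lin_comb A B v = cscale \<alpha> B + cscale \<beta> (B ** A) + cscale \<gamma> (B ** B) + cscale \<delta> (B ** (A ** B))"
    by (simp add: v lin_comb_def mult_add_right mult_cscale_right)
  then show ?thesis
    unfolding BAB BB BA v
    by (simp add: lin_comb_def mat2_eq_iff mat_entry algebra_simps)
qed

lemma adj2_mult_lin:
  assumes "trace M = x" "M ** lin_comb A B v = lin_comb A B (gen_coeffs r x g v)"
  shows "adj2 M ** lin_comb A B v = lin_comb A B (letter_coeffs r x (g, False) v)"
proof -
  have "adj2 M ** L = cscale (trace M) L - M ** L" for L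
    by (simp add: adj2_def mat2_eq_iff mult_entry mat_entry algebra_simps)
  then have *: "adj2 M ** lin_comb A B v = cscale x (lin_comb A B v) - lin_comb A B (gen_coeffs r x g v)"
    by (simp add: assms)
  obtain \<alpha> \<beta> \<gamma> \<delta> where v: "v = (\<alpha>, \<beta>, \<gamma>, \<delta>)" by (cases v)
  obtain \<alpha>' \<beta>' \<gamma>' \<delta>' where v': "gen_coeffs r x g (\<alpha>, \<beta>, \<gamma>, \<delta>) = (\<alpha>', \<beta>', \<gamma>', \<delta>')"
    by (cases "gen_coeffs r x g (\<alpha>, \<beta>, \<gamma>, \<delta>)")
  show ?thesis
    unfolding * unfolding v v' letter_coeffs.simps
    by (simp add: lin_comb_def mat2_eq_iff mult_entry mat_entry algebra_simps)
qed

lemma trace_lin: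
  assumes "trace A = x" "trace B = x" "trace (A ** adj2 B) = r"
  shows "trace (lin_comb A B (\<alpha>, \<beta>, \<gamma>, \<delta>)) = 2 * \<alpha> + x * \<beta> + x * \<gamma> + (x\<^sup>2 - r) * \<delta>"
proof -
  have "trace (A ** B) = trace A * trace B - trace (A ** adj2 B)"
    by (simp add: adj2_def trace_2 mult_entry mat_entry algebra_simps)
  then have "trace (A ** B) = x\<^sup>2 - r"
    by (simp add: assms power2_eq_square)
  moreover have "trace (lin_comb A B (\<alpha>, \<beta>, \<gamma>, \<delta>)) = 2 * \<alpha> + trace A * \<beta> + trace B * \<gamma> + trace (A ** B) * \<delta>"
    by (simp add: lin_comb_def trace_2 mat_entry algebra_simps)
  ultimately show ?thesis using assms by simp
qed

fun gens :: "'a \<Rightarrow> 'a \<Rightarrow> gen \<Rightarrow> 'a" where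
  "gens A B Gen_a = A"
| "gens A B Gen_b = B"

abbreviation eval2 :: "complex ^ 2 ^ 2 \<Rightarrow> complex ^ 2 ^ 2 \<Rightarrow> gen word \<Rightarrow> complex ^ 2 ^ 2" where
  "eval2 A B \<equiv> word_eval SL2 (gens A B)"

lemma lin_one: "lin_comb A B (1, 0, 0, 0) = mat 1"
  by (simp add: lin_comb_def mat2_eq_iff)

section \<open>The twist relation for a pair of matrices\<close>

text \<open>With \<open>P = A B\<^sup>-\<^sup>1\<close> and \<open>Q = A\<^sup>-\<^sup>1 B\<close>, the two outer factors are the powers that the twist
  regions contribute to the word \<open>w\<^sub>k\<close>.\<close>

lemma shifted_product:
  "(cscale f P - cscale f' (mat 1)) ** M ** (cscale f Q - cscale f' (mat 1)) =
    cscale (f * f) (P ** M ** Q) - cscale (f * f') (P ** M + M ** Q) + cscale (f' * f') M"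
  by (simp add: mat2_eq_iff mult_entry mat_entry algebra_simps)

text \<open>The pairs of matrices that lie over the point \<open>(r, x)\<close> of the plane.\<close>

locale matrix_pair =
  fixes A B :: "complex ^ 2 ^ 2" and r x :: complex
  assumes det_A [simp]: "det A = 1" and det_B [simp]: "det B = 1"
    and trace_A: "trace A = x" and trace_B: "trace B = x"
    and trace_AB': "trace (A ** adj2 B) = r"
begin

lemma gens_det [simp]: "det (gens A B g) = 1"
  by (cases g) simp_all

lemma eval2_det [simp]: "det (eval2 A B u) = 1"
  using SL2.word_eval_closed[of "gens A B" u] by simp

lemma eval2_append: "eval2 A B (u @ v) = eval2 A B u ** eval2 A B v"
  by (subst SL2.word_eval_append) simp_all

lemma eval2_lin: "eval2 A B u = lin_comb A B (word_coeffs r x u)"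
proof (induction u)
  case Nil
  show ?case by (simp add: lin_one)
next
  case (Cons s u)
  obtain g e where s: "s = (g, e)" by fastforce
  have gen: "gens A B g ** lin_comb A B v = lin_comb A B (gen_coeffs r x g v)" for v
    using mult_lin_A[of A x B v] mult_lin_B[of A x B r v]
    by (cases g) (simp_all add: trace_A trace_B trace_AB')
  have tr: "trace (gens A B g) = x"
    by (cases g) (simp_all add: trace_A trace_B)
  show ?case
    using gen adj2_mult_lin[OF tr gen] by (cases e) (simp_all add: s Cons inv_SL2)
qed

lemma eval2_trace:
  "trace (eval2 A B u) = (case word_coeffs r x u of (\<alpha>, \<beta>, \<gamma>, \<delta>) \<Rightarrow>
     2 * \<alpha> + x * \<beta> + x * \<gamma> + (x\<^sup>2 - r) * \<delta>)"
  by (cases "word_coeffs r x u") (simp add: eval2_lin trace_lin trace_A trace_B trace_AB')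

lemma eval2_pow:
  "eval2 A B (word_pow u n) = cscale (fval n (trace (eval2 A B u))) (eval2 A B u) -
     cscale (fval (n - 1) (trace (eval2 A B u))) (mat 1)"
  by (subst SL2.word_eval_pow) (simp_all add: SL2_pow)

lemma twist_word_even:
  fixes m :: int
  defines "f \<equiv> fval m r" and "f' \<equiv> fval (m - 1) r"
  shows "eval2 A B (twist_word (2 * m)) =
    lin_comb A B (f'\<^sup>2 - f\<^sup>2, x * (f\<^sup>2 - f * f'), x * (f\<^sup>2 - f * f'), 2 * f * f' - r * f\<^sup>2)"
proof -
  let ?P = "eval2 A B (wa @ wb')" and ?Q = "eval2 A B (wa' @ wb)"
  have P: "?P = lin_comb A B (0, x, 0, - 1)" and Q: "?Q = lin_comb A B (0, 0, x, - 1)"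
    by (simp_all only: eval2_lin) simp_all
  have PQ: "?P ** ?Q = lin_comb A B (- 1, x, x, - r)"
    by (simp only: eval2_append[symmetric], simp only: eval2_lin) (simp add: algebra_simps)
  have tr: "trace ?P = r" "trace ?Q = r"
    by (simp_all only: eval2_trace) (simp_all add: power2_eq_square algebra_simps)
  have "eval2 A B (twist_word (2 * m)) =
      (cscale f ?P - cscale f' (mat 1)) ** (cscale f ?Q - cscale f' (mat 1))"
    by (simp add: twist_word_def eval2_append[of "word_pow _ _"] eval2_pow tr[simplified] f_def f'_def)
  also have "\<dots> = cscale (f * f) (?P ** ?Q) - cscale (f * f') (?P + ?Q) + cscale (f' * f') (mat 1)"
    using shifted_product[of f ?P f' "mat 1" ?Q] by (simp only: matrix_mul_lid matrix_mul_rid)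
  finally show ?thesis
    unfolding PQ unfolding P Q
    by (simp add: lin_comb_def mat2_eq_iff mat_entry power2_eq_square algebra_simps)
qed

lemma twist_word_odd:
  fixes m :: int
  defines "f \<equiv> fval m r" and "f' \<equiv> fval (m - 1) r"
  shows "eval2 A B (twist_word (2 * m + 1)) =
    lin_comb A B (r * f\<^sup>2 - 2 * f * f', x * (f * f' - (r - 1) * f\<^sup>2), x * (f * f' - (r - 1) * f\<^sup>2),
      (r\<^sup>2 - 1) * f\<^sup>2 - 2 * r * f * f' + f'\<^sup>2)"
proof -
  let ?P = "eval2 A B (wa @ wb')" and ?Q = "eval2 A B (wa' @ wb)" and ?M = "eval2 A B (wa @ wb)"
  have M: "?M = lin_comb A B (0, 0, 0, 1)"
    by (simp_all only: eval2_lin) simp_all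
  have PM: "?P ** ?M = lin_comb A B (1, 0, - x, r)" and MQ: "?M ** ?Q = lin_comb A B (1, - x, 0, r)"
    by (simp_all only: eval2_append[symmetric], simp_all only: eval2_lin) (simp_all add: algebra_simps)
  have PMQ: "?P ** ?M ** ?Q = lin_comb A B (r, - (r - 1) * x, - (r - 1) * x, r\<^sup>2 - 1)"
    by (simp only: eval2_append[symmetric], simp only: eval2_lin) (simp add: power2_eq_square algebra_simps)
  have tr: "trace ?P = r" "trace ?Q = r"
    by (simp_all only: eval2_trace) (simp_all add: power2_eq_square algebra_simps)
  have split: "twist_word (2 * m + 1) = word_pow (wa @ wb') m @ (wa @ wb) @ word_pow (wa' @ wb) m"
    by (simp add: twist_word_def)
  have "eval2 A B (twist_word (2 * m + 1)) =
      (cscale f ?P - cscale f' (mat 1)) ** ?M ** (cscale f ?Q - cscale f' (mat 1))"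
    unfolding split eval2_append[of "word_pow _ _"] eval2_append[of "wa @ wb"] eval2_pow tr f_def f'_def
    by (simp only: matrix_mul_assoc)
  also have "\<dots> = cscale (f * f) (?P ** ?M ** ?Q) - cscale (f * f') (?P ** ?M + ?M ** ?Q) +
      cscale (f' * f') ?M"
    by (rule shifted_product)
  finally show ?thesis
    unfolding PMQ unfolding PM MQ unfolding M
    by (simp add: lin_comb_def mat2_eq_iff mat_entry power2_eq_square algebra_simps)
qed

text \<open>The coefficients of \<open>A\<close> and \<open>B\<close> in \<open>w\<^sub>k\<close> agree, because \<open>w\<^sub>k\<close> is fixed by the anti-automorphism
  that exchanges \<open>a\<close> and \<open>b\<close>. In both parities of \<open>k\<close>, the two formulas follow from the explicit
  coefficients and the quadratic relation \<open>f\<^sub>m\<^sup>2 + f\<^sub>m\<^sub>-\<^sub>1\<^sup>2 - r f\<^sub>m f\<^sub>m\<^sub>-\<^sub>1 = 1\<close>.\<close>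

lemma twist_word_symmetric:
  obtains \<alpha> \<beta> \<gamma> where "eval2 A B (twist_word k) = lin_comb A B (\<alpha>, \<beta>, \<beta>, \<gamma>)"
    and "\<alpha> + x * \<beta> + \<gamma> =
      1 - ipoly (Phi_poly (- k)) r * ipoly (Phi_poly (k - 1)) r * ((x\<^sup>2 - 2) - r)"
    and "trace (eval2 A B (twist_word k)) = t_poly k r (x\<^sup>2 - 2)"
proof (cases "even k")
  case True
  then obtain m where k: "k = 2 * m" by blast
  have e: "- (2 * m) = 2 * (- m)" "2 * m - 1 = 2 * (m - 1) + 1" by simp_all
  note inv = fval_invariant[of m r]
  show ?thesis
  proof (rule that[OF twist_word_even[of m, folded k]])
    show "(fval (m - 1) r)\<^sup>2 - (fval m r)\<^sup>2 + x * (x * ((fval m r)\<^sup>2 - fval m r * fval (m - 1) r)) +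
        (2 * fval m r * fval (m - 1) r - r * (fval m r)\<^sup>2) =
      1 - ipoly (Phi_poly (- k)) r * ipoly (Phi_poly (k - 1)) r * ((x\<^sup>2 - 2) - r)"
      unfolding k e Phi_even Phi_odd fval_minus diff_add_cancel using inv by algebra
    show "trace (eval2 A B (twist_word k)) = t_poly k r (x\<^sup>2 - 2)"
      unfolding k twist_word_even t_poly_def e Phi_even Psi_even fval_minus
        trace_lin[OF trace_A trace_B trace_AB'] using inv by algebra
  qed
next
  case False
  then obtain m where k: "k = 2 * m + 1" by (elim oddE)
  have e: "- (2 * m + 1) = 2 * (- (m + 1)) + 1" "2 * m + 1 - 1 = 2 * m" "- (m + 1) + 1 = - m"
    by simp_all
  note inv = fval_invariant[of m r]
  show ?thesis
  proof (rule that[OF twist_word_odd[of m, folded k]])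
    show "r * (fval m r)\<^sup>2 - 2 * fval m r * fval (m - 1) r +
        x * (x * (fval m r * fval (m - 1) r - (r - 1) * (fval m r)\<^sup>2)) +
        ((r\<^sup>2 - 1) * (fval m r)\<^sup>2 - 2 * r * fval m r * fval (m - 1) r + (fval (m - 1) r)\<^sup>2) =
      1 - ipoly (Phi_poly (- k)) r * ipoly (Phi_poly (k - 1)) r * ((x\<^sup>2 - 2) - r)"
      unfolding k e(1,2) Phi_even Phi_odd e(3) fval_minus fval_Suc using inv by algebra
    show "trace (eval2 A B (twist_word k)) = t_poly k r (x\<^sup>2 - 2)"
      unfolding k twist_word_odd t_poly_def e(1) Phi_odd Psi_odd e(3) fval_minus fval_Suc
        trace_lin[OF trace_A trace_B trace_AB'] using inv by algebra
  qed
qed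

text \<open>For the terms \<open>1, A + B, A B\<close> this rests on \<open>A\<^sup>2 - B\<^sup>2 = x (A - B)\<close> and
  \<open>A\<^sup>2 B - A B\<^sup>2 = A - B\<close>, both consequences of the Cayley-Hamilton theorem.\<close>

lemma symmetric_defect:
  "A ** lin_comb A B (\<alpha>, \<beta>, \<beta>, \<gamma>) - lin_comb A B (\<alpha>, \<beta>, \<beta>, \<gamma>) ** B = cscale (\<alpha> + x * \<beta> + \<gamma>) (A - B)"
proof -
  have "A ** lin_comb A B (\<alpha>, \<beta>, \<beta>, \<gamma>) - lin_comb A B (\<alpha>, \<beta>, \<beta>, \<gamma>) ** B =
      cscale \<alpha> (A - B) + cscale \<beta> (A ** A - B ** B) + cscale \<gamma> ((A ** A) ** B - A ** (B ** B))"
    by (simp add: lin_comb_def mat2_eq_iff mult_entry mat_entry algebra_simps)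
  then show ?thesis
    unfolding cayley_hamilton_2 trace_A trace_B det_A det_B
    by (simp add: mat2_eq_iff mult_entry mat_entry algebra_simps)
qed

lemma relation_iff:
  fixes k l :: int
  defines "W \<equiv> eval2 A B (word_pow (twist_word k) (l div 2))"
  shows "A ** W = W ** B \<longleftrightarrow> A = B \<or> (r, x\<^sup>2 - 2) \<in> C_set k l"
proof -
  obtain \<alpha> \<beta> \<gamma> where w: "eval2 A B (twist_word k) = lin_comb A B (\<alpha>, \<beta>, \<beta>, \<gamma>)"
    and c: "\<alpha> + x * \<beta> + \<gamma> =
      1 - ipoly (Phi_poly (- k)) r * ipoly (Phi_poly (k - 1)) r * ((x\<^sup>2 - 2) - r)"
    and t: "trace (eval2 A B (twist_word k)) = t_poly k r (x\<^sup>2 - 2)"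
    by (rule twist_word_symmetric)
  define f where "f = fval (l div 2) (t_poly k r (x\<^sup>2 - 2))"
  define f' where "f' = fval (l div 2 - 1) (t_poly k r (x\<^sup>2 - 2))"
  let ?L = "lin_comb A B (\<alpha>, \<beta>, \<beta>, \<gamma>)" and ?c = "\<alpha> + x * \<beta> + \<gamma>"
  have W: "W = cscale f ?L - cscale f' (mat 1)"
    unfolding W_def eval2_pow t f_def f'_def unfolding w ..
  have "A ** W - W ** B = cscale f (A ** ?L - ?L ** B) - cscale f' (A - B)"
    unfolding W by (simp add: mat2_eq_iff mult_entry mat_entry algebra_simps)
  also have "\<dots> = cscale (f * ?c - f') (A - B)"
    unfolding symmetric_defect by (simp add: mat2_eq_iff algebra_simps)
  finally have eq: "A ** W - W ** B = cscale (f * ?c - f') (A - B)" .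
  have "A ** W = W ** B \<longleftrightarrow> A ** W - W ** B = 0" by simp
  also have "\<dots> \<longleftrightarrow> f * ?c - f' = 0 \<or> A = B"
    unfolding eq by (auto simp: mat2_eq_iff)
  also have "f * ?c - f' = 0 \<longleftrightarrow> (r, x\<^sup>2 - 2) \<in> C_set k l"
  proof -
    let ?p = "ipoly (Phi_poly (- k)) r * ipoly (Phi_poly (k - 1)) r * ((x\<^sup>2 - 2) - r)"
    have "f * ?c - f' = - (f * (?p - 1) + f')"
      unfolding c by (simp add: algebra_simps)
    moreover have "(r, x\<^sup>2 - 2) \<in> C_set k l \<longleftrightarrow> f * (?p - 1) + f' = 0"
      by (simp add: C_set_def Let_def f_def f'_def)
    ultimately show ?thesis by (simp only: neg_equal_0_iff_equal)
  qed
  finally show ?thesis by blast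
qed

text \<open>If the generators coincide, all words are polynomials in one matrix.\<close>

lemma eval2_commute:
  assumes "A = B"
  shows "eval2 A B u ** eval2 A B v = eval2 A B v ** eval2 A B u"
proof -
  have "\<exists>p q. lin_comb A A w = cscale p (mat 1) + cscale q A" for w
  proof -
    obtain \<alpha> \<beta> \<gamma> \<delta> where w: "w = (\<alpha>, \<beta>, \<gamma>, \<delta>)" by (cases w)
    have "lin_comb A A w = cscale (\<alpha> - \<delta>) (mat 1) + cscale (\<beta> + \<gamma> + x * \<delta>) A"
      unfolding w lin_comb_def by (simp add: cayley_hamilton_2 trace_A mat2_eq_iff mat_entry algebra_simps)
    then show ?thesis by blast
  qed
  then obtain p q p' q' where "lin_comb A A (word_coeffs r x u) = cscale p (mat 1) + cscale q A"
    "lin_comb A A (word_coeffs r x v) = cscale p' (mat 1) + cscale q' A" by metis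
  moreover have "eval2 A B w = lin_comb A A (word_coeffs r x w)" for w
    using eval2_lin[of w] assms by simp
  ultimately show ?thesis
    by (simp add: mat2_eq_iff mult_entry mat_entry algebra_simps)
qed

end

text \<open>For \<open>y = r\<close> one has \<open>t = 2\<close>, and the equation of the curve becomes \<open>-n + (n - 1) = 0\<close>.\<close>

lemma C_set_off_diagonal:
  assumes "(r, y) \<in> C_set k l"
  shows "y \<noteq> r"
proof
  assume "y = r"
  then have t: "t_poly k r r = 2" by (simp add: t_poly_def)
  show False using assms by (simp add: C_set_def Let_def t fval_at_2 \<open>y = r\<close>)
qed

text \<open>Riley's triangular pair. A matrix that commutes with the nonscalar upper triangular matrix \<open>A\<close> is a
  polynomial in \<open>A\<close>, hence upper triangular, and for \<open>r \<noteq> 2\<close> the matrix \<open>B\<close> is not.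
  For \<open>r = 2\<close> the matrix \<open>B\<close> is diagonal, and it commutes with \<open>A\<close> only if its
  eigenvalues are equal, that is, if \<open>x\<^sup>2 = 4\<close>, which is the excluded case \<open>x\<^sup>2 - 2 = r\<close>.\<close>

lemma noncommuting_pair_exists:
  assumes "x\<^sup>2 - 2 \<noteq> r"
  obtains A B where "matrix_pair A B r x" "A ** B \<noteq> B ** A"
proof -
  \<comment> \<open>The numbers \<open>m\<close> and \<open>x - m\<close> are the eigenvalues of a unimodular matrix of trace \<open>x\<close>.\<close>
  define m where "m = (x + csqrt (x\<^sup>2 - 4)) / 2"
  have "2 * m - x = csqrt (x\<^sup>2 - 4)" by (simp add: m_def add_divide_distrib)
  then have "(2 * m - x)\<^sup>2 = x\<^sup>2 - 4" by (simp only: power2_csqrt)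
  then have m: "m * (x - m) = 1" by algebra
  define A :: "complex ^ 2 ^ 2" where "A = vector [vector [m, 1], vector [0, x - m]]"
  define B :: "complex ^ 2 ^ 2" where "B = vector [vector [m, 0], vector [2 - r, x - m]]"
  have A: "A $ 1 $ 1 = m" "A $ 1 $ 2 = 1" "A $ 2 $ 1 = 0" "A $ 2 $ 2 = x - m"
    by (simp_all add: A_def)
  have B: "B $ 1 $ 1 = m" "B $ 1 $ 2 = 0" "B $ 2 $ 1 = 2 - r" "B $ 2 $ 2 = x - m"
    by (simp_all add: B_def)
  have "matrix_pair A B r x"
  proof
    have "trace (A ** adj2 B) = 2 * (m * (x - m)) + r - 2"
      by (simp add: mat2_simps A B algebra_simps)
    then show "trace (A ** adj2 B) = r" by (simp add: m)
  qed (simp_all add: mat2_simps A B m)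
  moreover have "A ** B \<noteq> B ** A"
  proof
    assume "A ** B = B ** A"
    then have "r = 2" "x - m = m"
      by (auto simp: mat2_eq_iff mult_entry A B)
    with m have "x\<^sup>2 - 2 = r" by algebra
    with assms show False ..
  qed
  ultimately show thesis by (rule that)
qed

section \<open>Polynomial functions on the plane\<close>

lemma generated_algebra_diff:
  assumes "F \<in> generated_algebra E" "H \<in> generated_algebra E"
  shows "(\<lambda>p. F p - H p) \<in> generated_algebra E"
proof -
  have "(\<lambda>p. F p + (- 1) * H p) \<in> generated_algebra E"
    by (intro generated_algebra.add generated_algebra.mult generated_algebra.const assms)
  then show ?thesis by simp
qed

lemma generated_algebra_uminus:
  "F \<in> generated_algebra E \<Longrightarrow> (\<lambda>p. - F p) \<in> generated_algebra E"
  using generated_algebra_diff[OF generated_algebra.const[of 0]] by simp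

abbreviation plane_algebra :: "(complex \<times> complex \<Rightarrow> complex) set" where
  "plane_algebra \<equiv> generated_algebra {fst, snd}"

lemma plane_coords: "fst \<in> plane_algebra" "snd \<in> plane_algebra"
  by (simp_all add: generated_algebra.gen)

lemmas plane_intros = generated_algebra.add generated_algebra.mult generated_algebra_diff
  generated_algebra_uminus generated_algebra.const plane_coords

lemma plane_algebra_substitute:
  assumes "F \<in> plane_algebra" "f \<in> generated_algebra E" "g \<in> generated_algebra E"
  shows "(\<lambda>\<xi>. F (f \<xi>, g \<xi>)) \<in> generated_algebra E"
  using assms(1) by induction (auto intro: generated_algebra.intros assms)

text \<open>Polynomials in \<open>x\<close> are sums of an even and an odd part; the even polynomials are written in terms of
  \<open>y = x\<^sup>2 - 2\<close>, the coordinate on the quotient.\<close>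

lemma plane_algebra_even_odd:
  assumes "F \<in> plane_algebra"
  shows "\<exists>P\<in>plane_algebra. \<exists>R\<in>plane_algebra. \<forall>r x. F (r, x) = P (r, x\<^sup>2 - 2) + x * R (r, x\<^sup>2 - 2)"
  using assms
proof induction
  case (const c)
  show ?case
    by (intro bexI[of _ "\<lambda>_. c"] bexI[of _ "\<lambda>_. 0"]) (auto intro: plane_intros)
next
  case (gen F)
  then consider "F = fst" | "F = snd" by blast
  then show ?case
  proof cases
    case 1
    show ?thesis
      by (intro bexI[of _ fst] bexI[of _ "\<lambda>_. 0"]) (auto intro: plane_intros simp: 1)
  next
    case 2
    show ?thesis
      by (intro bexI[of _ "\<lambda>_. 0"] bexI[of _ "\<lambda>_. 1"]) (auto intro: plane_intros simp: 2)
  qed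
next
  case (add F F')
  then obtain P R P' R' where
    "P \<in> plane_algebra" "R \<in> plane_algebra" "P' \<in> plane_algebra" "R' \<in> plane_algebra"
    "\<And>r x. F (r, x) = P (r, x\<^sup>2 - 2) + x * R (r, x\<^sup>2 - 2)"
    "\<And>r x. F' (r, x) = P' (r, x\<^sup>2 - 2) + x * R' (r, x\<^sup>2 - 2)" by metis
  then show ?case
    by (intro bexI[of _ "\<lambda>p. P p + P' p"] bexI[of _ "\<lambda>p. R p + R' p"])
      (auto intro: plane_intros simp: algebra_simps)
next
  case (mult F F')
  then obtain P R P' R' where
    "P \<in> plane_algebra" "R \<in> plane_algebra" "P' \<in> plane_algebra" "R' \<in> plane_algebra"
    "\<And>r x. F (r, x) = P (r, x\<^sup>2 - 2) + x * R (r, x\<^sup>2 - 2)"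
    "\<And>r x. F' (r, x) = P' (r, x\<^sup>2 - 2) + x * R' (r, x\<^sup>2 - 2)" by metis
  then show ?case
    \<comment> \<open>The product of the odd parts contributes \<open>x\<^sup>2 = y + 2\<close> to the even part.\<close>
    by (intro bexI[of _ "\<lambda>p. P p * P' p + (snd p + 2) * (R p * R' p)"]
        bexI[of _ "\<lambda>p. P p * R' p + R p * P' p"])
      (auto intro!: plane_intros simp: algebra_simps power2_eq_square)
qed

text \<open>The trace of a word as a function of \<open>(r, x)\<close>: the matrices \<open>1, A, B, A B\<close> have traces
  \<open>2, x, x, x\<^sup>2 - r\<close>.\<close>

definition trace_poly :: "gen word \<Rightarrow> complex \<times> complex \<Rightarrow> complex" where
  "trace_poly u = (\<lambda>(r, x). case word_coeffs r x u of (\<alpha>, \<beta>, \<gamma>, \<delta>) \<Rightarrow>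
     2 * \<alpha> + x * \<beta> + x * \<gamma> + (x\<^sup>2 - r) * \<delta>)"

lemma word_coeffs_polynomial:
  "\<exists>\<alpha>\<in>plane_algebra. \<exists>\<beta>\<in>plane_algebra. \<exists>\<gamma>\<in>plane_algebra. \<exists>\<delta>\<in>plane_algebra.
    \<forall>p. word_coeffs (fst p) (snd p) u = (\<alpha> p, \<beta> p, \<gamma> p, \<delta> p)"
proof (induction u)
  case Nil
  show ?case
    by (intro bexI[of _ "\<lambda>_. 1"] bexI[of _ "\<lambda>_. 0"]) (auto intro: plane_intros)
next
  case (Cons s u)
  then obtain \<alpha> \<beta> \<gamma> \<delta> where mem: "\<alpha> \<in> plane_algebra" "\<beta> \<in> plane_algebra" "\<gamma> \<in> plane_algebra"
    "\<delta> \<in> plane_algebra" and eq: "\<And>p. word_coeffs (fst p) (snd p) u = (\<alpha> p, \<beta> p, \<gamma> p, \<delta> p)"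
    by blast
  obtain g e where s: "s = (g, e)" by fastforce
  obtain \<alpha>' \<beta>' \<gamma>' \<delta>' where mem': "\<alpha>' \<in> plane_algebra" "\<beta>' \<in> plane_algebra" "\<gamma>' \<in> plane_algebra"
    "\<delta>' \<in> plane_algebra" and
    eq': "\<And>p. gen_coeffs (fst p) (snd p) g (\<alpha> p, \<beta> p, \<gamma> p, \<delta> p) = (\<alpha>' p, \<beta>' p, \<gamma>' p, \<delta>' p)"
  proof (cases g)
    case Gen_a
    show thesis
      by (rule that[of "\<lambda>p. - \<beta> p" "\<lambda>p. \<alpha> p + snd p * \<beta> p" "\<lambda>p. - \<delta> p" "\<lambda>p. \<gamma> p + snd p * \<delta> p"])
        (auto intro!: plane_intros mem simp: Gen_a)
  next
    case Gen_b
    show thesis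
      by (rule that[of "\<lambda>p. - fst p * \<beta> p - \<gamma> p - snd p * \<delta> p" "\<lambda>p. snd p * \<beta> p + \<delta> p"
          "\<lambda>p. \<alpha> p + snd p * \<beta> p + snd p * \<gamma> p + (snd p * snd p - fst p) * \<delta> p" "\<lambda>p. - \<beta> p"])
        (auto intro!: plane_intros mem simp: Gen_b)
  qed
  show ?case
  proof (cases e)
    case True
    then show ?thesis using mem' by (auto simp: s eq eq')
  next
    case False
    show ?thesis
      by (rule bexI[of _ "\<lambda>p. snd p * \<alpha> p - \<alpha>' p"], rule bexI[of _ "\<lambda>p. snd p * \<beta> p - \<beta>' p"],
          rule bexI[of _ "\<lambda>p. snd p * \<gamma> p - \<gamma>' p"], rule bexI[of _ "\<lambda>p. snd p * \<delta> p - \<delta>' p"])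
        (auto intro!: plane_intros mem mem' simp: False s eq eq')
  qed
qed

lemma trace_poly_polynomial: "trace_poly u \<in> plane_algebra"
proof -
  obtain \<alpha> \<beta> \<gamma> \<delta> where mem: "\<alpha> \<in> plane_algebra" "\<beta> \<in> plane_algebra" "\<gamma> \<in> plane_algebra" "\<delta> \<in> plane_algebra"
    and eq: "\<And>p. word_coeffs (fst p) (snd p) u = (\<alpha> p, \<beta> p, \<gamma> p, \<delta> p)"
    using word_coeffs_polynomial[of u] by blast
  have "trace_poly u = (\<lambda>p. 2 * \<alpha> p + snd p * \<beta> p + snd p * \<gamma> p + (snd p * snd p - fst p) * \<delta> p)"
  proof
    fix p :: "complex \<times> complex"
    show "trace_poly u p = 2 * \<alpha> p + snd p * \<beta> p + snd p * \<gamma> p + (snd p * snd p - fst p) * \<delta> p"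
      using eq[of p] by (simp add: trace_poly_def case_prod_beta[of _ p] power2_eq_square)
  qed
  moreover have "\<dots> \<in> plane_algebra"
    by (intro plane_intros mem)
  ultimately show ?thesis by simp
qed

section \<open>The action of the signs\<close>

lemma group_sign_group: "group sign_group"
  by (rule groupI) (auto simp: sign_group_def)

lemma sign_group_simps: "c \<in> carrier sign_group \<longleftrightarrow> c = 1 \<or> c = - 1" "c \<otimes>\<^bsub>sign_group\<^esub> d = c * d"
  by (simp_all add: sign_group_def)

lemma sign_hom:
  assumes "\<sigma> \<in> hom \<Gamma> sign_group" "\<gamma> \<in> carrier \<Gamma>"
  shows "\<sigma> \<gamma> * \<sigma> \<gamma> = 1" "\<sigma> \<gamma> = 1 \<or> \<sigma> \<gamma> = - 1"
    "\<delta> \<in> carrier \<Gamma> \<Longrightarrow> \<sigma> (\<gamma> \<otimes>\<^bsub>\<Gamma>\<^esub> \<delta>) = \<sigma> \<gamma> * \<sigma> \<delta>"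
proof -
  show *: "\<sigma> \<gamma> = 1 \<or> \<sigma> \<gamma> = - 1"
    using hom_in_carrier[OF assms] by (simp add: sign_group_simps)
  then show "\<sigma> \<gamma> * \<sigma> \<gamma> = 1" by auto
  show "\<sigma> (\<gamma> \<otimes>\<^bsub>\<Gamma>\<^esub> \<delta>) = \<sigma> \<gamma> * \<sigma> \<delta>" if "\<delta> \<in> carrier \<Gamma>"
    using hom_mult[OF assms(1,2) that] by (simp add: sign_group_simps)
qed

text \<open>The signs form a group of exponent two, so multiplication by \<open>\<tau>\<close> permutes the homomorphisms to
  them and undoes itself.\<close>

lemma sign_orbit_twist:
  assumes \<tau>: "\<tau> \<in> hom \<Gamma> sign_group"
  shows "sign_orbit \<Gamma> (\<lambda>\<gamma>\<in>carrier \<Gamma>. \<tau> \<gamma> * \<xi> \<gamma>) = sign_orbit \<Gamma> \<xi>"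
proof -
  let ?\<eta> = "\<lambda>\<gamma>\<in>carrier \<Gamma>. \<tau> \<gamma> * \<xi> \<gamma>"
  have prod: "(\<lambda>\<gamma>. \<sigma> \<gamma> * \<tau> \<gamma>) \<in> hom \<Gamma> sign_group" if \<sigma>: "\<sigma> \<in> hom \<Gamma> sign_group" for \<sigma>
  proof (rule homI)
    fix \<gamma> assume g: "\<gamma> \<in> carrier \<Gamma>"
    show "\<sigma> \<gamma> * \<tau> \<gamma> \<in> carrier sign_group"
      using sign_hom(2)[OF \<sigma> g] sign_hom(2)[OF \<tau> g] by (auto simp: sign_group_simps)
    fix \<delta> assume "\<delta> \<in> carrier \<Gamma>"
    then show "\<sigma> (\<gamma> \<otimes>\<^bsub>\<Gamma>\<^esub> \<delta>) * \<tau> (\<gamma> \<otimes>\<^bsub>\<Gamma>\<^esub> \<delta>) = \<sigma> \<gamma> * \<tau> \<gamma> \<otimes>\<^bsub>sign_group\<^esub> (\<sigma> \<delta> * \<tau> \<delta>)"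
      using sign_hom(3)[OF \<sigma> g] sign_hom(3)[OF \<tau> g] by (simp add: sign_group_simps)
  qed
  have "(\<lambda>\<gamma>\<in>carrier \<Gamma>. \<sigma> \<gamma> * ?\<eta> \<gamma>) = (\<lambda>\<gamma>\<in>carrier \<Gamma>. (\<sigma> \<gamma> * \<tau> \<gamma>) * \<xi> \<gamma>)" for \<sigma>
    by (auto simp: mult.assoc)
  then have "sign_orbit \<Gamma> ?\<eta> \<subseteq> sign_orbit \<Gamma> \<xi>"
    unfolding sign_orbit_def using prod by fastforce
  moreover have "(\<lambda>\<gamma>\<in>carrier \<Gamma>. \<sigma> \<gamma> * \<xi> \<gamma>) = (\<lambda>\<gamma>\<in>carrier \<Gamma>. (\<sigma> \<gamma> * \<tau> \<gamma>) * ?\<eta> \<gamma>)" for \<sigma>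
  proof (rule restrict_ext)
    fix \<gamma> assume g: "\<gamma> \<in> carrier \<Gamma>"
    have "\<sigma> \<gamma> * \<tau> \<gamma> * (\<tau> \<gamma> * \<xi> \<gamma>) = \<sigma> \<gamma> * (\<tau> \<gamma> * \<tau> \<gamma>) * \<xi> \<gamma>" by (simp only: mult.assoc)
    then show "\<sigma> \<gamma> * \<xi> \<gamma> = (\<sigma> \<gamma> * \<tau> \<gamma>) * ?\<eta> \<gamma>"
      using g sign_hom(1)[OF \<tau> g] by simp
  qed
  then have "sign_orbit \<Gamma> \<xi> \<subseteq> sign_orbit \<Gamma> ?\<eta>"
    unfolding sign_orbit_def using prod by fastforce
  ultimately show ?thesis by blast
qed

lemma char_in_sign_orbit: "char_of \<Gamma> \<rho> \<in> sign_orbit \<Gamma> (char_of \<Gamma> \<rho>)"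
proof -
  have "(\<lambda>_. 1) \<in> hom \<Gamma> sign_group" by (auto simp: hom_def sign_group_def)
  moreover have "char_of \<Gamma> \<rho> = (\<lambda>\<gamma>\<in>carrier \<Gamma>. 1 * char_of \<Gamma> \<rho> \<gamma>)"
    by (auto simp: char_of_def)
  ultimately show ?thesis unfolding sign_orbit_def by (intro CollectI exI[of _ "\<lambda>_. 1"]) simp
qed

section \<open>Representations of the knot group\<close>

locale twist_knot =
  fixes k l :: int
    and \<Gamma> :: "('g, 'm) monoid_scheme" (structure)
    and \<theta> :: "gen word set \<Rightarrow> 'g"
    and a b :: 'g
  assumes group_\<Gamma>: "group \<Gamma>"
    and \<theta>_iso: "\<theta> \<in> iso (twist_knot_group k l) \<Gamma>"
    and a_def: "a = \<theta> (meridian_a k l)"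
    and b_def: "b = \<theta> (meridian_b k l)"
begin

sublocale group \<Gamma>
  by (rule group_\<Gamma>)

definition elt :: "gen word \<Rightarrow> 'g" where
  "elt u = \<theta> (word_class (twist_relations k l) u)"

lemma \<theta>_hom: "\<theta> \<in> hom (presented_group (twist_relations k l)) \<Gamma>"
  using \<theta>_iso by (simp add: iso_def twist_knot_group_def)

lemma carrier_eq: "carrier \<Gamma> = range elt"
proof -
  have "carrier \<Gamma> = \<theta> ` carrier (twist_knot_group k l)"
    using \<theta>_iso by (simp add: iso_def bij_betw_def)
  then show ?thesis
    by (simp add: elt_def twist_knot_group_def presented_group_def image_image)
qed

lemma elt_closed [simp]: "elt u \<in> carrier \<Gamma>"
  by (simp add: carrier_eq)

lemma a_elt: "a = elt wa" and b_elt: "b = elt wb"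
  by (simp_all add: a_def b_def elt_def meridian_a_def meridian_b_def)

lemma a_closed [simp]: "a \<in> carrier \<Gamma>" and b_closed [simp]: "b \<in> carrier \<Gamma>"
  by (simp_all add: a_elt b_elt)

lemma hom_elt:
  assumes "group H" "\<rho> \<in> hom \<Gamma> H"
  shows "\<rho> (elt u) = word_eval H (gens (\<rho> a) (\<rho> b)) u"
proof -
  have "\<rho> \<circ> \<theta> \<in> hom (presented_group (twist_relations k l)) H"
    by (rule Group.hom_compose[OF \<theta>_hom assms(2)])
  from group.presented_hom_eval[OF assms(1) this, of u]
  have "\<rho> (elt u) = word_eval H (\<lambda>x. \<rho> (elt [(x, True)])) u"
    by (simp add: elt_def)
  moreover have "(\<lambda>x. \<rho> (elt [(x, True)])) = gens (\<rho> a) (\<rho> b)"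
  proof
    fix x show "\<rho> (elt [(x, True)]) = gens (\<rho> a) (\<rho> b) x"
      by (cases x) (simp_all add: a_elt b_elt)
  qed
  ultimately show ?thesis by simp
qed

lemma elt_eval: "elt u = word_eval \<Gamma> (gens a b) u"
proof -
  have "id \<in> hom \<Gamma> \<Gamma>" by (simp add: hom_def)
  from hom_elt[OF group_\<Gamma> this, of u] show ?thesis by simp
qed

lemma ab'_elt: "a \<otimes> inv b = elt (wa @ wb')"
  by (simp add: elt_eval)

lemma aa_elt: "a \<otimes> a = elt (wa @ wa)"
  by (simp add: elt_eval)

text \<open>Two target groups occur: \<open>SL\<^sub>2\<close>, for the representations, and the group of signs, for the action
  on the characters.\<close>

lemma hom_relation:
  fixes H (structure)
  assumes "group H" "\<rho> \<in> hom \<Gamma> H"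
  defines "W \<equiv> word_eval H (gens (\<rho> a) (\<rho> b)) (word_pow (twist_word k) (l div 2))"
  shows "\<rho> a \<otimes>\<^bsub>H\<^esub> W = W \<otimes>\<^bsub>H\<^esub> \<rho> b" "W \<in> carrier H"
proof -
  interpret H: group H by fact
  have h: "gens (\<rho> a) (\<rho> b) x \<in> carrier H" for x
    using hom_in_carrier[OF assms(2)] by (cases x) simp_all
  let ?w = "word_pow (twist_word k) (l div 2)"
  have "word_cong (twist_relations k l) (wa @ ?w) (?w @ wb)"
    using word_cong.rel[of "wa @ ?w" "?w @ wb" "twist_relations k l" "[]" "[]"]
    by (simp add: twist_relations_def)
  then have "elt (wa @ ?w) = elt (?w @ wb)"
    unfolding elt_def by (simp only: word_class_eq_iff[symmetric])
  then have "word_eval H (gens (\<rho> a) (\<rho> b)) (wa @ ?w) = word_eval H (gens (\<rho> a) (\<rho> b)) (?w @ wb)"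
    using hom_elt[OF assms(1,2)] by metis
  moreover show "W \<in> carrier H"
    unfolding W_def by (rule H.word_eval_closed[OF h])
  ultimately show "\<rho> a \<otimes>\<^bsub>H\<^esub> W = W \<otimes>\<^bsub>H\<^esub> \<rho> b"
    using h[of Gen_b] by (simp add: H.word_eval_append[OF h] W_def)
qed

lemma hom_exists:
  fixes H (structure)
  assumes "group H" "A \<in> carrier H" "B \<in> carrier H"
  defines "W \<equiv> word_eval H (gens A B) (word_pow (twist_word k) (l div 2))"
  assumes "A \<otimes>\<^bsub>H\<^esub> W = W \<otimes>\<^bsub>H\<^esub> B"
  obtains \<rho> where "\<rho> \<in> hom \<Gamma> H" "\<rho> a = A" "\<rho> b = B"
proof -
  interpret H: group H by fact
  interpret P: group "twist_knot_group k l"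
    unfolding twist_knot_group_def by (rule group_presented_group)
  have h: "gens A B x \<in> carrier H" for x using assms(2,3) by (cases x) simp_all
  let ?R = "twist_relations k l"
  have "word_eval H (gens A B) s = word_eval H (gens A B) t" if "(s, t) \<in> ?R" for s t
    using that assms(3,5) by (simp add: twist_relations_def H.word_eval_append[OF h] W_def)
  then obtain \<rho> where \<rho>: "\<rho> \<in> hom (presented_group ?R) H"
    and eval: "\<And>u. \<rho> (word_class ?R u) = word_eval H (gens A B) u"
    using H.presented_hom_exists[of "gens A B" ?R] h by blast
  let ?\<theta>' = "inv_into (carrier (twist_knot_group k l)) \<theta>"
  have "?\<theta>' \<in> hom \<Gamma> (presented_group ?R)"
    using P.iso_set_sym[OF \<theta>_iso] by (simp add: iso_def twist_knot_group_def)
  then have "\<rho> \<circ> ?\<theta>' \<in> hom \<Gamma> H"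
    using \<rho> by (rule Group.hom_compose)
  moreover have "(\<rho> \<circ> ?\<theta>') (elt u) = word_eval H (gens A B) u" for u
  proof -
    have "inj_on \<theta> (carrier (twist_knot_group k l))"
      using \<theta>_iso by (simp add: iso_def bij_betw_def)
    moreover have "word_class ?R u \<in> carrier (twist_knot_group k l)"
      by (simp add: twist_knot_group_def presented_group_def)
    ultimately show ?thesis by (simp add: elt_def eval)
  qed
  ultimately show thesis
    using that[of "\<rho> \<circ> ?\<theta>'"] assms(2,3) by (simp add: a_elt b_elt)
qed

section \<open>The variety of nonabelian characters\<close>

abbreviation chars :: "('g \<Rightarrow> complex) set" where
  "chars \<equiv> char_of \<Gamma> ` hom \<Gamma> SL2"

definition coords :: "('g \<Rightarrow> complex) \<Rightarrow> complex \<times> complex" where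
  "coords \<xi> = (\<xi> (a \<otimes> inv b), \<xi> a)"

text \<open>The relation conjugates the images of the two meridians by the image of
  \<open>w\<^sub>k\<^sup>n\<close>, so they have the same trace.\<close>

lemma rep_pair:
  assumes "\<rho> \<in> hom \<Gamma> SL2"
  shows "matrix_pair (\<rho> a) (\<rho> b) (char_of \<Gamma> \<rho> (a \<otimes> inv b)) (char_of \<Gamma> \<rho> a)"
proof
  show "det (\<rho> a) = 1" and b: "det (\<rho> b) = 1"
    using hom_in_carrier[OF assms a_closed] hom_in_carrier[OF assms b_closed] by simp_all
  show "trace (\<rho> a) = char_of \<Gamma> \<rho> a" by (simp add: char_of_def)
  obtain W where W: "\<rho> a ** W = W ** \<rho> b" "det W = 1"
    using hom_relation[OF group_SL2 assms] by auto
  have "\<rho> b = adj2 W ** (W ** \<rho> b)"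
    by (simp add: matrix_mul_assoc adj2_mult W(2))
  then have "trace (\<rho> b) = trace (adj2 W ** (\<rho> a ** W))"
    by (simp add: W(1))
  also have "\<dots> = trace (\<rho> a ** (W ** adj2 W))"
    by (subst trace_mul_sym) (simp only: matrix_mul_assoc)
  finally show "trace (\<rho> b) = char_of \<Gamma> \<rho> a"
    by (simp add: adj2_mult W(2) char_of_def)
  have "\<rho> (a \<otimes> inv b) = \<rho> a ** adj2 (\<rho> b)"
    unfolding ab'_elt hom_elt[OF group_SL2 assms] using b by (simp add: inv_SL2)
  then show "trace (\<rho> a ** adj2 (\<rho> b)) = char_of \<Gamma> \<rho> (a \<otimes> inv b)"
    by (simp add: char_of_def)
qed

lemma char_elt:
  assumes "\<xi> \<in> chars"
  shows "\<xi> (elt u) = trace_poly u (coords \<xi>)"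
proof -
  obtain \<rho> where \<rho>: "\<rho> \<in> hom \<Gamma> SL2" "\<xi> = char_of \<Gamma> \<rho>" using assms by blast
  interpret matrix_pair "\<rho> a" "\<rho> b" "\<xi> (a \<otimes> inv b)" "\<xi> a"
    unfolding \<rho>(2) by (rule rep_pair[OF \<rho>(1)])
  have "\<xi> (elt u) = trace (eval2 (\<rho> a) (\<rho> b) u)"
    by (simp add: \<rho>(2) char_of_def hom_elt[OF group_SL2 \<rho>(1)])
  then show ?thesis by (simp add: eval2_trace trace_poly_def coords_def)
qed

lemma char_aa: "\<xi> \<in> chars \<Longrightarrow> \<xi> (a \<otimes> a) = (\<xi> a)\<^sup>2 - 2"
  by (simp add: aa_elt char_elt) (simp add: trace_poly_def coords_def power2_eq_square)

lemma char_eqI: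
  assumes "\<xi> \<in> chars" "\<eta> \<in> chars" "coords \<xi> = coords \<eta>"
  shows "\<xi> = \<eta>"
proof
  fix \<gamma>
  show "\<xi> \<gamma> = \<eta> \<gamma>"
  proof (cases "\<gamma> \<in> carrier \<Gamma>")
    case True
    then obtain u where "\<gamma> = elt u" by (auto simp: carrier_eq)
    then show ?thesis by (simp only: char_elt[OF assms(1)] char_elt[OF assms(2)] assms(3))
  next
    case False
    then show ?thesis using assms(1,2) by (auto simp: char_of_def)
  qed
qed

lemma nonabelian_chars_subset: "nonabelian_chars \<Gamma> \<subseteq> chars"
  by (auto simp: nonabelian_chars_def)

text \<open>A nonabelian representation has distinct images of the meridians, so the relation forces the equation
  of the curve. Over a point of the curve, the equation makes a noncommuting pair of matrices a
  representation.\<close>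

lemma coords_nonabelian:
  "coords ` nonabelian_chars \<Gamma> = {(r, x). (r, x\<^sup>2 - 2) \<in> C_set k l}" (is "_ = ?D")
proof (intro equalityI subsetI)
  fix p assume "p \<in> coords ` nonabelian_chars \<Gamma>"
  then obtain \<rho> where \<rho>: "\<rho> \<in> hom \<Gamma> SL2" "nonabelian_rep \<Gamma> \<rho>" and p: "p = coords (char_of \<Gamma> \<rho>)"
    by (auto simp: nonabelian_chars_def)
  interpret matrix_pair "\<rho> a" "\<rho> b" "char_of \<Gamma> \<rho> (a \<otimes> inv b)" "char_of \<Gamma> \<rho> a"
    by (rule rep_pair[OF \<rho>(1)])
  have "\<rho> a \<noteq> \<rho> b"
  proof
    assume "\<rho> a = \<rho> b"
    then have "\<rho> (elt u) ** \<rho> (elt v) = \<rho> (elt v) ** \<rho> (elt u)" for u v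
      unfolding hom_elt[OF group_SL2 \<rho>(1)] by (rule eval2_commute)
    with \<rho>(2) show False by (auto simp: nonabelian_rep_def carrier_eq)
  qed
  then show "p \<in> ?D"
    using hom_relation(1)[OF group_SL2 \<rho>(1)] relation_iff[of k l] by (simp add: p coords_def)
next
  fix p assume "p \<in> ?D"
  then obtain r x where p: "p = (r, x)" and C: "(r, x\<^sup>2 - 2) \<in> C_set k l" by blast
  obtain A B where pair: "matrix_pair A B r x" and AB: "A ** B \<noteq> B ** A"
    using noncommuting_pair_exists[OF C_set_off_diagonal[OF C]] by blast
  interpret matrix_pair A B r x by (rule pair)
  obtain \<rho> where \<rho>: "\<rho> \<in> hom \<Gamma> SL2" "\<rho> a = A" "\<rho> b = B"
    using hom_exists[OF group_SL2, of A B] relation_iff[of k l] C by auto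
  have "char_of \<Gamma> \<rho> \<in> nonabelian_chars \<Gamma>"
    using \<rho> AB a_closed b_closed unfolding nonabelian_chars_def nonabelian_rep_def by blast
  moreover have "coords (char_of \<Gamma> \<rho>) = p"
    using matrix_pair.trace_AB'[OF rep_pair[OF \<rho>(1)]] trace_A trace_AB'
    by (simp add: p coords_def \<rho> char_of_def)
  ultimately show "p \<in> coords ` nonabelian_chars \<Gamma>" by blast
qed

lemma coords_bij: "bij_betw coords (nonabelian_chars \<Gamma>) {(r, x). (r, x\<^sup>2 - 2) \<in> C_set k l}"
  unfolding bij_betw_def coords_nonabelian
proof
  show "inj_on coords (nonabelian_chars \<Gamma>)"
    using nonabelian_chars_subset by (intro inj_onI char_eqI) blast+
qed simp

abbreviation evaluations :: "(('g \<Rightarrow> complex) \<Rightarrow> complex) set" where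
  "evaluations \<equiv> (\<lambda>\<gamma> \<xi>. \<xi> \<gamma>) ` carrier \<Gamma>"

lemma evaluation_in_algebra: "\<gamma> \<in> carrier \<Gamma> \<Longrightarrow> (\<lambda>\<xi>. \<xi> \<gamma>) \<in> generated_algebra evaluations"
  by (intro generated_algebra.gen) blast

text \<open>Generators of the coordinate ring are evaluations at group elements, and these are the trace
  polynomials of words.\<close>

lemma evaluations_polynomial:
  assumes "G \<in> generated_algebra evaluations"
  obtains F where "F \<in> plane_algebra" "\<And>\<xi>. \<xi> \<in> chars \<Longrightarrow> G \<xi> = F (coords \<xi>)"
proof -
  have "\<exists>F\<in>plane_algebra. \<forall>\<xi>\<in>chars. G \<xi> = F (coords \<xi>)"
    using assms
  proof induction
    case (const c)
    show ?case by (intro bexI[of _ "\<lambda>_. c"]) (auto intro: plane_intros)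
  next
    case (gen G)
    then obtain u where "G = (\<lambda>\<xi>. \<xi> (elt u))" by (auto simp: carrier_eq)
    then show ?case
      using char_elt by (intro bexI[of _ "trace_poly u"]) (simp_all add: trace_poly_polynomial)
  next
    case (add G G')
    then obtain F F' where "F \<in> plane_algebra" "F' \<in> plane_algebra"
      "\<forall>\<xi>\<in>chars. G \<xi> = F (coords \<xi>)" "\<forall>\<xi>\<in>chars. G' \<xi> = F' (coords \<xi>)" by blast
    then show ?case by (intro bexI[of _ "\<lambda>p. F p + F' p"]) (auto intro: plane_intros)
  next
    case (mult G G')
    then obtain F F' where "F \<in> plane_algebra" "F' \<in> plane_algebra"
      "\<forall>\<xi>\<in>chars. G \<xi> = F (coords \<xi>)" "\<forall>\<xi>\<in>chars. G' \<xi> = F' (coords \<xi>)" by blast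
    then show ?case by (intro bexI[of _ "\<lambda>p. F p * F' p"]) (auto intro: plane_intros)
  qed
  then show thesis using that by blast
qed

lemma X_iso: "variety_iso coords (X_variety \<Gamma>) (C_double_cover k l)"
proof -
  let ?X = "nonabelian_chars \<Gamma>" and ?D = "{(r, x). (r, x\<^sup>2 - 2) \<in> C_set k l}"
  have D: "coords \<xi> \<in> ?D" if "\<xi> \<in> ?X" for \<xi>
    using imageI[OF that, of coords] unfolding coords_nonabelian .
  have regX: "regular (X_variety \<Gamma>) = (\<lambda>G. restrict G ?X) ` generated_algebra evaluations"
  proof -
    have "restrict (restrict G chars) ?X = restrict G ?X" for G :: "_ \<Rightarrow> complex"
      by (simp add: Int_absorb1[OF nonabelian_chars_subset])
    then show ?thesis
      by (simp add: X_variety_def X_tilde_def subvariety_def variety_with_coords_def image_image)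
  qed
  have regD: "regular (C_double_cover k l) = (\<lambda>F. restrict F ?D) ` plane_algebra"
    by (simp add: C_double_cover_def affine_plane_def subvariety_def variety_with_coords_def image_image)
  have pull: "restrict (\<lambda>\<xi>. restrict F ?D (coords \<xi>)) ?X = restrict (\<lambda>\<xi>. F (coords \<xi>)) ?X" for F :: "_ \<Rightarrow> complex"
    using D by (auto intro!: restrict_ext)
  have "(\<lambda>F. restrict (\<lambda>\<xi>. F (coords \<xi>)) ?X) ` plane_algebra =
      (\<lambda>G. restrict G ?X) ` generated_algebra evaluations"
  proof (intro equalityI subsetI)
    fix h assume "h \<in> (\<lambda>F. restrict (\<lambda>\<xi>. F (coords \<xi>)) ?X) ` plane_algebra"
    then obtain F where F: "F \<in> plane_algebra" and h: "h = restrict (\<lambda>\<xi>. F (coords \<xi>)) ?X" by blast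
    have "(\<lambda>\<xi>. F (coords \<xi>)) \<in> generated_algebra evaluations"
      unfolding coords_def
      by (intro plane_algebra_substitute F evaluation_in_algebra) simp_all
    then show "h \<in> (\<lambda>G. restrict G ?X) ` generated_algebra evaluations" unfolding h by (rule imageI)
  next
    fix h assume "h \<in> (\<lambda>G. restrict G ?X) ` generated_algebra evaluations"
    then obtain G where G: "G \<in> generated_algebra evaluations" and h: "h = restrict G ?X" by blast
    obtain F where "F \<in> plane_algebra" "\<And>\<xi>. \<xi> \<in> chars \<Longrightarrow> G \<xi> = F (coords \<xi>)"
      using evaluations_polynomial[OF G] by blast
    moreover from this have "h = restrict (\<lambda>\<xi>. F (coords \<xi>)) ?X"
      unfolding h using nonabelian_chars_subset by (intro restrict_ext) blast
    ultimately show "h \<in> (\<lambda>F. restrict (\<lambda>\<xi>. F (coords \<xi>)) ?X) ` plane_algebra" by blast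
  qed
  moreover have "points (X_variety \<Gamma>) = ?X" "points (C_double_cover k l) = ?D"
    by (simp_all add: X_variety_def C_double_cover_def subvariety_def)
  ultimately show ?thesis
    using coords_bij by (simp only: variety_iso_def regX regD image_image pull)
qed

section \<open>The quotient by the signs\<close>

text \<open>In an abelian group the relation identifies the two meridians.\<close>

lemma sign_hom_meridians:
  assumes "\<sigma> \<in> hom \<Gamma> sign_group"
  shows "\<sigma> (a \<otimes> inv b) = 1" "\<sigma> (a \<otimes> a) = 1"
proof -
  obtain w where w: "\<sigma> a * w = w * \<sigma> b" "w = 1 \<or> w = - 1"
    using hom_relation[OF group_sign_group assms] by (auto simp: sign_group_simps)
  then have "\<sigma> a = \<sigma> b" by auto
  moreover have "\<sigma> (a \<otimes> inv b) * \<sigma> b = \<sigma> a"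
    using sign_hom(3)[OF assms, of "a \<otimes> inv b" b] by (simp add: m_assoc)
  ultimately show "\<sigma> (a \<otimes> inv b) = 1"
    using sign_hom(2)[OF assms b_closed] by auto
  show "\<sigma> (a \<otimes> a) = 1"
    using sign_hom[OF assms a_closed] by simp
qed

definition orbit_coords :: "('g \<Rightarrow> complex) \<Rightarrow> complex \<times> complex" where
  "orbit_coords \<xi> = (\<xi> (a \<otimes> inv b), \<xi> (a \<otimes> a))"

lemma orbit_coords_eq: "\<xi> \<in> chars \<Longrightarrow> orbit_coords \<xi> = (fst (coords \<xi>), (snd (coords \<xi>))\<^sup>2 - 2)"
  by (simp add: orbit_coords_def coords_def char_aa)

lemma orbit_coords_cong:
  assumes "\<xi> \<in> chars" "sign_orbit \<Gamma> \<xi> = sign_orbit \<Gamma> \<eta>"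
  shows "orbit_coords \<xi> = orbit_coords \<eta>"
proof -
  have "\<xi> \<in> sign_orbit \<Gamma> \<xi>" using assms(1) char_in_sign_orbit by blast
  then obtain \<sigma> where \<sigma>: "\<sigma> \<in> hom \<Gamma> sign_group" "\<xi> = (\<lambda>\<gamma>\<in>carrier \<Gamma>. \<sigma> \<gamma> * \<eta> \<gamma>)"
    unfolding assms(2) by (auto simp: sign_orbit_def)
  show ?thesis
    using sign_hom_meridians[OF \<sigma>(1)] by (simp add: orbit_coords_def \<sigma>(2))
qed

text \<open>The nontrivial sign sends both meridians to \<open>-1\<close>; the relation holds because signs commute. The new
  character belongs to the representation with all matrices multiplied by the sign.\<close>

lemma char_negate:
  assumes "\<xi> \<in> chars"
  obtains \<eta> where "\<eta> \<in> chars" "sign_orbit \<Gamma> \<eta> = sign_orbit \<Gamma> \<xi>"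
    "coords \<eta> = (fst (coords \<xi>), - snd (coords \<xi>))"
proof -
  obtain \<rho> where \<rho>: "\<rho> \<in> hom \<Gamma> SL2" "\<xi> = char_of \<Gamma> \<rho>" using assms by blast
  have "- 1 \<in> carrier sign_group" by (simp add: sign_group_simps)
  then obtain \<tau> where \<tau>: "\<tau> \<in> hom \<Gamma> sign_group" "\<tau> a = - 1"
    using hom_exists[OF group_sign_group, of "- 1" "- 1"] by (auto simp: sign_group_simps)
  define \<eta> where "\<eta> = (\<lambda>\<gamma>\<in>carrier \<Gamma>. \<tau> \<gamma> * \<xi> \<gamma>)"
  define \<rho>' where "\<rho>' \<gamma> = cscale (\<tau> \<gamma>) (\<rho> \<gamma>)" for \<gamma>
  have "\<rho>' \<in> hom \<Gamma> SL2"
  proof (rule homI)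
    fix \<gamma> assume g: "\<gamma> \<in> carrier \<Gamma>"
    have "det (\<rho>' \<gamma>) = \<tau> \<gamma> * \<tau> \<gamma> * det (\<rho> \<gamma>)"
      by (simp add: \<rho>'_def det_2 algebra_simps)
    then show "\<rho>' \<gamma> \<in> carrier SL2"
      using sign_hom(1)[OF \<tau>(1) g] hom_in_carrier[OF \<rho>(1) g] by simp
    fix \<delta> assume d: "\<delta> \<in> carrier \<Gamma>"
    have "\<rho> (\<gamma> \<otimes> \<delta>) = \<rho> \<gamma> ** \<rho> \<delta>" using hom_mult[OF \<rho>(1) g d] by simp
    then show "\<rho>' (\<gamma> \<otimes> \<delta>) = \<rho>' \<gamma> \<otimes>\<^bsub>SL2\<^esub> \<rho>' \<delta>"
      using sign_hom(3)[OF \<tau>(1) g d] by (simp add: \<rho>'_def mat2_eq_iff mult_entry algebra_simps)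
  qed
  moreover have "\<eta> = char_of \<Gamma> \<rho>'"
    by (auto simp: \<eta>_def \<rho>(2) char_of_def \<rho>'_def trace_2 algebra_simps)
  ultimately have "\<eta> \<in> chars" by blast
  moreover have "sign_orbit \<Gamma> \<eta> = sign_orbit \<Gamma> \<xi>"
    unfolding \<eta>_def by (rule sign_orbit_twist[OF \<tau>(1)])
  moreover have "coords \<eta> = (fst (coords \<xi>), - snd (coords \<xi>))"
    using sign_hom_meridians(1)[OF \<tau>(1)] \<tau>(2) by (simp add: coords_def \<eta>_def)
  ultimately show thesis by (rule that)
qed

text \<open>Characters with equal \<open>r\<close> and \<open>x\<^sup>2\<close> have equal or opposite \<open>x\<close>; in the second case the
  nontrivial sign takes one to the other.\<close>

lemma sign_orbit_eqI:
  assumes "\<xi> \<in> chars" "\<eta> \<in> chars" "orbit_coords \<xi> = orbit_coords \<eta>"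
  shows "sign_orbit \<Gamma> \<xi> = sign_orbit \<Gamma> \<eta>"
proof -
  obtain \<zeta> where \<zeta>: "\<zeta> \<in> chars" "sign_orbit \<Gamma> \<zeta> = sign_orbit \<Gamma> \<xi>"
    "coords \<zeta> = (fst (coords \<xi>), - snd (coords \<xi>))"
    using char_negate[OF assms(1)] by blast
  have "fst (coords \<xi>) = fst (coords \<eta>)" "(snd (coords \<xi>))\<^sup>2 = (snd (coords \<eta>))\<^sup>2"
    using assms by (simp_all add: orbit_coords_eq)
  then have "coords \<xi> = coords \<eta> \<or> coords \<zeta> = coords \<eta>"
    by (auto simp: \<zeta>(3) power2_eq_iff prod_eq_iff)
  then show ?thesis
    using char_eqI[OF assms(1,2)] char_eqI[OF \<zeta>(1) assms(2)] \<zeta>(2) by auto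
qed

text \<open>The value at an orbit is read off from a chosen character in \<open>chars\<close>; by \<open>orbit_coords_cong\<close> it
  is independent of the choice.\<close>

definition plane_point :: "('g \<Rightarrow> complex) set \<Rightarrow> complex \<times> complex" where
  "plane_point C = orbit_coords (SOME \<xi>. \<xi> \<in> chars \<and> sign_orbit \<Gamma> \<xi> = C)"

lemma plane_point_orbit:
  assumes "\<xi> \<in> chars"
  shows "plane_point (sign_orbit \<Gamma> \<xi>) = orbit_coords \<xi>"
proof -
  let ?\<eta> = "SOME \<eta>. \<eta> \<in> chars \<and> sign_orbit \<Gamma> \<eta> = sign_orbit \<Gamma> \<xi>"
  have "?\<eta> \<in> chars \<and> sign_orbit \<Gamma> ?\<eta> = sign_orbit \<Gamma> \<xi>"
    by (rule someI[of _ \<xi>]) (use assms in simp)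
  then show ?thesis
    unfolding plane_point_def by (intro orbit_coords_cong) blast+
qed

lemma plane_point_bij:
  "bij_betw plane_point (sign_orbit \<Gamma> ` nonabelian_chars \<Gamma>) (C_set k l)"
  unfolding bij_betw_def
proof
  show "inj_on plane_point (sign_orbit \<Gamma> ` nonabelian_chars \<Gamma>)"
  proof (rule inj_onI)
    fix C D
    assume "C \<in> sign_orbit \<Gamma> ` nonabelian_chars \<Gamma>" "D \<in> sign_orbit \<Gamma> ` nonabelian_chars \<Gamma>"
    then obtain \<xi> \<eta> where "\<xi> \<in> chars" "\<eta> \<in> chars" "C = sign_orbit \<Gamma> \<xi>" "D = sign_orbit \<Gamma> \<eta>"
      using nonabelian_chars_subset by blast
    then show "plane_point C = plane_point D \<Longrightarrow> C = D"
      using sign_orbit_eqI[of \<xi> \<eta>] by (simp add: plane_point_orbit)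
  qed
  have "plane_point ` sign_orbit \<Gamma> ` nonabelian_chars \<Gamma> =
      (\<lambda>(r, x). (r, x\<^sup>2 - 2)) ` coords ` nonabelian_chars \<Gamma>"
    unfolding image_image using nonabelian_chars_subset
    by (intro image_cong refl)
      (auto simp: plane_point_orbit orbit_coords_eq subset_iff case_prod_beta)
  also have "\<dots> = C_set k l"
  proof -
    \<comment> \<open>A square root of \<open>y + 2\<close> lifts the point to the double cover.\<close>
    have "(r, y) \<in> (\<lambda>(r, x). (r, x\<^sup>2 - 2)) ` {(r, x). (r, x\<^sup>2 - 2) \<in> C_set k l}"
      if "(r, y) \<in> C_set k l" for r y
      using that by (intro image_eqI[of _ _ "(r, csqrt (y + 2))"]) simp_all
    then show ?thesis unfolding coords_nonabelian by auto
  qed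
  finally show "plane_point ` sign_orbit \<Gamma> ` nonabelian_chars \<Gamma> = C_set k l" .
qed

text \<open>A regular function on the quotient pulls back to an invariant polynomial in \<open>r\<close> and \<open>x\<close>. Invariance
  under \<open>x \<mapsto> -x\<close> kills its odd part on the characters, and the even part is a polynomial
  in \<open>r\<close> and \<open>y\<close>.\<close>

lemma Y_iso: "variety_iso plane_point (Y_variety \<Gamma>) (C_variety k l)"
proof -
  let ?q = "sign_orbit \<Gamma>" and ?C = "C_set k l"
  let ?Q = "?q ` chars" and ?Y = "?q ` nonabelian_chars \<Gamma>"
  let ?I = "{F \<in> extensional ?Q. restrict (\<lambda>\<xi>. F (?q \<xi>)) chars \<in>
      (\<lambda>G. restrict G chars) ` generated_algebra evaluations}"
  have YQ: "?Y \<subseteq> ?Q" using nonabelian_chars_subset by blast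
  have regY: "regular (Y_variety \<Gamma>) = (\<lambda>F. restrict F ?Y) ` ?I"
    by (simp add: Y_variety_def X_tilde_def subvariety_def quotient_variety_def variety_with_coords_def)
  have regC: "regular (C_variety k l) = (\<lambda>F. restrict F ?C) ` plane_algebra"
    by (simp add: C_variety_def affine_plane_def subvariety_def variety_with_coords_def image_image)
  have pull: "restrict (\<lambda>p. restrict F ?C (plane_point p)) ?Y = restrict (\<lambda>p. F (plane_point p)) ?Y"
    for F :: "_ \<Rightarrow> complex"
    using plane_point_bij by (intro restrict_ext) (auto simp: bij_betw_def)
  have "(\<lambda>F. restrict (\<lambda>p. F (plane_point p)) ?Y) ` plane_algebra = (\<lambda>F. restrict F ?Y) ` ?I"
  proof (intro equalityI subsetI)
    fix h assume "h \<in> (\<lambda>F. restrict (\<lambda>p. F (plane_point p)) ?Y) ` plane_algebra"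
    then obtain F where F: "F \<in> plane_algebra" and h: "h = restrict (\<lambda>p. F (plane_point p)) ?Y" by blast
    let ?F = "restrict (\<lambda>p. F (plane_point p)) ?Q"
    have "(\<lambda>\<xi>. F (orbit_coords \<xi>)) \<in> generated_algebra evaluations"
      unfolding orbit_coords_def
      by (intro plane_algebra_substitute F evaluation_in_algebra) simp_all
    moreover have "restrict (\<lambda>\<xi>. ?F (?q \<xi>)) chars = restrict (\<lambda>\<xi>. F (orbit_coords \<xi>)) chars"
      by (intro restrict_ext) (simp add: plane_point_orbit)
    ultimately have "?F \<in> ?I" by simp
    moreover have "h = restrict ?F ?Y"
      unfolding h using YQ by (intro restrict_ext) auto
    ultimately show "h \<in> (\<lambda>F. restrict F ?Y) ` ?I" by blast
  next
    fix h assume "h \<in> (\<lambda>F. restrict F ?Y) ` ?I"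
    then obtain F G where h: "h = restrict F ?Y" and G: "G \<in> generated_algebra evaluations"
      and FG: "restrict (\<lambda>\<xi>. F (?q \<xi>)) chars = restrict G chars" by blast
    obtain H where H: "H \<in> plane_algebra" "\<And>\<xi>. \<xi> \<in> chars \<Longrightarrow> G \<xi> = H (coords \<xi>)"
      using evaluations_polynomial[OF G] by blast
    have FH: "F (?q \<xi>) = H (coords \<xi>)" if "\<xi> \<in> chars" for \<xi>
      using fun_cong[OF FG, of \<xi>] that H(2) by simp
    obtain P R where P: "P \<in> plane_algebra"
      and PR: "\<And>r x. H (r, x) = P (r, x\<^sup>2 - 2) + x * R (r, x\<^sup>2 - 2)"
      using plane_algebra_even_odd[OF H(1)] by blast
    have "F (?q \<xi>) = P (orbit_coords \<xi>)" if \<xi>: "\<xi> \<in> chars" for \<xi>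
    proof -
      obtain \<eta> where \<eta>: "\<eta> \<in> chars" "?q \<eta> = ?q \<xi>" "coords \<eta> = (fst (coords \<xi>), - snd (coords \<xi>))"
        using char_negate[OF \<xi>] by blast
      obtain r x where rx: "coords \<xi> = (r, x)" by (cases "coords \<xi>")
      have "H (r, x) = H (r, - x)"
        using FH[OF \<xi>] FH[OF \<eta>(1)] \<eta>(2,3) rx by simp
      then have "x * R (r, x\<^sup>2 - 2) = 0" by (simp add: PR)
      then show ?thesis using FH[OF \<xi>] by (simp add: rx PR orbit_coords_eq[OF \<xi>])
    qed
    then have "h = restrict (\<lambda>p. P (plane_point p)) ?Y"
      unfolding h using nonabelian_chars_subset
      by (intro restrict_ext) (auto simp: plane_point_orbit subset_iff)
    with P show "h \<in> (\<lambda>F. restrict (\<lambda>p. F (plane_point p)) ?Y) ` plane_algebra" by blast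
  qed
  moreover have "points (Y_variety \<Gamma>) = ?Y" "points (C_variety k l) = ?C"
    by (simp_all add: Y_variety_def C_variety_def subvariety_def)
  ultimately show ?thesis
    using plane_point_bij unfolding variety_iso_def regY regC by (simp only: image_image[of _ _ plane_algebra] pull)
qed

end

theorem proposition3p8:
  fixes k l :: int
    and \<Gamma> :: "('g, 'm) monoid_scheme"
    and \<theta> :: "gen word set \<Rightarrow> 'g"
    and a b :: 'g
  assumes "even l"
    and "group \<Gamma>"
    and "\<theta> \<in> iso (twist_knot_group k l) \<Gamma>"
    and "a = \<theta> (meridian_a k l)"
    and "b = \<theta> (meridian_b k l)"
  shows "(\<exists>\<phi>. variety_iso \<phi> (Y_variety \<Gamma>) (C_variety k l) \<and>
            (\<forall>\<xi>\<in>points (X_variety \<Gamma>).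
               \<phi> (sign_orbit \<Gamma> \<xi>) = (\<xi> (a \<otimes>\<^bsub>\<Gamma>\<^esub> inv\<^bsub>\<Gamma>\<^esub> b), \<xi> (a \<otimes>\<^bsub>\<Gamma>\<^esub> a)))) \<and>
         (\<exists>\<psi>. variety_iso \<psi> (X_variety \<Gamma>) (C_double_cover k l) \<and>
            (\<forall>\<xi>\<in>points (X_variety \<Gamma>).
               \<psi> \<xi> = (\<xi> (a \<otimes>\<^bsub>\<Gamma>\<^esub> inv\<^bsub>\<Gamma>\<^esub> b), \<xi> a)))"
proof -
  interpret twist_knot k l \<Gamma> \<theta> a b
    by (rule twist_knot.intro) (use assms in auto)
  have "\<xi> \<in> chars" if "\<xi> \<in> points (X_variety \<Gamma>)" for \<xi>
    using that nonabelian_chars_subset by (auto simp: X_variety_def subvariety_def)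
  then have "\<forall>\<xi>\<in>points (X_variety \<Gamma>). plane_point (sign_orbit \<Gamma> \<xi>) = orbit_coords \<xi>"
    using plane_point_orbit by blast
  then show ?thesis
    using X_iso Y_iso unfolding orbit_coords_def coords_def[symmetric] by blast
qed

end
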